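(* Let $n\ge 1$, $N=2n$. Let $\alpha$ and $\beta$ be independent random permutations of $[N]$, with $\alpha$ uniform on the set $\mathcal C_2$ of the $(N-1)!!$ fixed-point-free involutions of $[N]$ and $\beta$ uniform on the set $\mathcal C_N$ of the $(N-1)!$ $N$-cycles of $[N]$. Let $X_n$ be the number of cycles of $\gamma=\alpha\beta$. Then for every $\nu\in[1,N]$, \[ \mathrm P(X_n=\nu)=[x^Ny^{\nu}]\sum_{\lambda_1=1}^N(-1)^{\lambda^1}F(N,\lambda_1)\,[\xi^{\lambda_1}]\left[\frac{\xi}{1-\xi}\left(\frac{1-x}{1-x\xi}\right)^y\right], \] equivalently \[ \mathrm E[y^{X_n}]=\sum_{\lambda_1=1}^N(-1)^{\lambda^1}F(N,\lambda_1)\,[\xi^{\lambda_1}x^N]\left[\frac{\xi}{1-\xi}\left(\frac{1-x}{1-x\xi}\right)^y\right]. \]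
   Context: $[\cdot]$ denotes coefficient extraction in formal power series. For $1\le\lambda_1\le N$ set $\lambda^1=N+1-\lambda_1$. Define $F(N,\lambda_1)=(-1)^{(\lambda^1-1)/2}\binom{(N-2)/2}{(\lambda_1-2)/2}\big/\binom{N-1}{\lambda_1-1}$ if $\lambda_1$ is even, and $F(N,\lambda_1)=(-1)^{(\lambda^1+2)/2}\binom{(N-2)/2}{(\lambda_1-1)/2}\big/\binom{N-1}{\lambda_1-1}$ if $\lambda_1$ is odd. *)

theory Defs
  imports "HOL-Probability.Probability" "HOL-Combinatorics.Combinatorics"
          "HOL-Computational_Algebra.Formal_Power_Series"
begin

definition fpf_involutions :: "'a set \<Rightarrow> ('a \<Rightarrow> 'a) set" where
  "fpf_involutions S = {a. a permutes S \<and> (\<forall>i\<in>S. a (a i) = i \<and> a i \<noteq> i)}"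

definition full_cycles :: "'a set \<Rightarrow> ('a \<Rightarrow> 'a) set" where
  "full_cycles S = {b. b permutes S \<and> cyclic_on b S}"

definition num_cycles :: "'a set \<Rightarrow> ('a \<Rightarrow> 'a) \<Rightarrow> nat" where
  "num_cycles S g = card ((\<lambda>i. orbit g i) ` S)"

definition F :: "nat \<Rightarrow> nat \<Rightarrow> real" where
  "F N l = (let lu = N + 1 - l in
     if even l then (-1) ^ ((lu - 1) div 2) * real (((N - 2) div 2) choose ((l - 2) div 2))
                      / real ((N - 1) choose (l - 1))
     else (-1) ^ ((lu + 2) div 2) * real (((N - 2) div 2) choose ((l - 1) div 2))
                      / real ((N - 1) choose (l - 1)))"

text \<open>Bivariate power series as x-series with coefficients in real xi-series
  (xi = fps_X of the inner ring).  (1-x)^y and (1-x xi)^(-y) are given by the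
  binomial series, i.e. fps_binomial composed with -X (and substituting x xi).\<close>
definition one_minus_x_pow :: "real \<Rightarrow> real fps fps" where
  "one_minus_x_pow y = Abs_fps (\<lambda>a. fps_const (fps_nth (fps_binomial y oo (- fps_X)) a))"

definition one_minus_xxi_pow :: "real \<Rightarrow> real fps fps" where
  "one_minus_xxi_pow y =
     Abs_fps (\<lambda>b. fps_const (fps_nth (fps_binomial (- y) oo (- fps_X)) b) * fps_X ^ b)"

definition GF :: "real \<Rightarrow> real fps fps" where
  "GF y = fps_const (fps_X * inverse (1 - fps_X)) * one_minus_x_pow y * one_minus_xxi_pow y"

end

theory Submission
  imports Defs
begin

text \<open>
  A permutation \<open>b\<close> of an \<open>N\<close>-element set \<open>X\<close> is an \<open>N\<close>-cycle iff
  \<open>\<Sum> \<bar>S\<bar> (-1)^(number of cycles of b in S)\<close>, taken over the \<open>b\<close>-invariant \<open>S \<subseteq> X\<close>, does not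
  vanish, and then the sum is \<open>-N\<close>. Hence, for a fixed fixed-point-free involution \<open>a\<close>, the sum of
  \<open>y^(cycles of a b)\<close> over all \<open>N\<close>-cycles \<open>b\<close> becomes a signed sum over \<open>S\<close> and over the
  permutations \<open>b\<close> stabilizing \<open>S\<close>. The contribution of \<open>S\<close> is \<open>0\<close> if at least two points of \<open>S\<close>
  have their partner outside \<open>S\<close>. If there is no such point, \<open>a\<close> is absorbed into \<open>b\<close> at the cost
  of a sign, and the sum factors into two rising factorials; if there is exactly one such point
  \<open>s\<close>, the only difference is that the transposition of \<open>s\<close> and \<open>a s\<close> merges a cycle of \<open>b\<close> in
  \<open>S\<close> with one outside \<open>S\<close>.

  Up to sign, the total over all \<open>S\<close> with \<open>m\<close> elements is \<open>H(m) - H(m - 1)\<close> with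
  \<open>H(m) = \<chi>(m) D(m)\<close>, where \<open>\<chi>(m)\<close> is the character of the hook \<open>(N - m, 1^m)\<close> at \<open>a\<close> and \<open>D(m)\<close>
  its content product, so summation by parts leaves \<open>\<Sum> H(m)\<close> over \<open>m < N\<close>. On the other side,
  \<open>F\<close> is, up to sign, \<open>\<chi>(m)\<close> divided by a binomial coefficient, and the coefficients of the
  generating function are partial sums of a Vandermonde convolution, which are multiples of \<open>D(m)\<close>.
\<close>

section \<open>Cycle counts\<close>

lemma orbit_eq_if_mem_orbit:
  assumes "permutation f" "x \<in> orbit f y"
  shows "orbit f x = orbit f y"
  using assms cyclic_on_orbit' orbit_cyclic_eq3 by fast

lemma orbit_subset_if_closed:
  assumes "x \<in> A" "\<And>z. z \<in> A \<Longrightarrow> f z \<in> A"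
  shows "orbit f x \<subseteq> A"
proof
  fix z assume "z \<in> orbit f x"
  then show "z \<in> A" by induct (use assms in auto)
qed

lemma orbit_transpose_comp_subset:
  assumes "\<And>z. z \<in> A \<Longrightarrow> f z \<in> A" "s \<in> A" "t \<in> A" "x \<in> A"
  shows "orbit (Transposition.transpose s t \<circ> f) x \<subseteq> A"
  by (rule orbit_subset_if_closed) (use assms in \<open>auto simp: Transposition.transpose_def\<close>)

lemma mem_orbit_transpose_comp:
  assumes "permutation f" "t \<notin> orbit f s"
  shows "t \<in> orbit (Transposition.transpose s t \<circ> f) s"
proof (rule ccontr)
  let ?g = "Transposition.transpose s t \<circ> f"
  assume t: "t \<notin> orbit ?g s"
  have perm_g: "permutation ?g"
    by (intro permutation_compose permutation_swap_id assms)
  have g_eq: "?g z = f z" if "f z \<in> orbit f s" "?g z \<in> orbit ?g s" for z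
    using that assms(2) t by (auto simp: Transposition.transpose_def split: if_splits)
  have orbit_g: "z \<in> orbit f s" if "z \<in> orbit ?g s" for z
    using that
  proof induct
    case base
    show ?case using g_eq[of s] orbit.base[of f s] orbit.base[of ?g s] by simp
  next
    case (step z)
    show ?case using g_eq[of z] orbit.step[OF step(1)] orbit.step[OF step(2)] by simp
  qed
  obtain w where w: "?g w = s"
    using perm_g permutation_bijective bij_pointE by metis
  have "w \<in> orbit ?g s"
    using permutation_self_in_orbit[OF perm_g, of w] permutation_orbit_step[OF perm_g, of w] w
    by simp
  then have "f w \<in> orbit f s" by (intro orbit.step orbit_g)
  moreover have "f w = t" using w by (auto simp: transpose_eq_iff)
  ultimately show False using assms(2) by simp
qed

lemma orbit_transpose_comp:
  assumes "permutation f" "t \<notin> orbit f s"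
  shows "orbit (Transposition.transpose s t \<circ> f) s = orbit f s \<union> orbit f t"
proof
  let ?g = "Transposition.transpose s t \<circ> f"
  have perm_g: "permutation ?g"
    by (intro permutation_compose permutation_swap_id assms)
  note self = permutation_self_in_orbit[OF assms(1)] permutation_self_in_orbit[OF perm_g]
  show "orbit ?g s \<subseteq> orbit f s \<union> orbit f t"
    by (rule orbit_transpose_comp_subset) (use self orbit.step[of _ f] in auto)
  have f_conv_g: "Transposition.transpose s t \<circ> ?g = f" by (simp add: fun_eq_iff)
  have "orbit (Transposition.transpose s t \<circ> ?g) x \<subseteq> orbit ?g s" if "x \<in> {s, t}" for x
    by (rule orbit_transpose_comp_subset)
      (use that self mem_orbit_transpose_comp[OF assms] orbit.step[of _ ?g] in auto)
  then show "orbit f s \<union> orbit f t \<subseteq> orbit ?g s"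
    unfolding f_conv_g by blast
qed

lemma orbit_transpose_comp_other:
  assumes "permutation f" "s \<notin> orbit f x" "t \<notin> orbit f x"
  shows "orbit (Transposition.transpose s t \<circ> f) x = orbit f x"
proof (rule orbit_cong)
  show "x \<in> orbit f x" using assms(1) by (rule permutation_self_in_orbit)
  fix z assume "z \<in> orbit f x"
  then have "f z \<in> orbit f x" by (rule orbit.step)
  then have "f z \<noteq> s" "f z \<noteq> t" using assms by auto
  then show "(Transposition.transpose s t \<circ> f) z = f z" by simp
qed

lemma num_cycles_transpose_comp:
  assumes "f permutes X" "finite X" "s \<in> X" "t \<in> X" "t \<notin> orbit f s"
  shows "num_cycles X f = Suc (num_cycles X (Transposition.transpose s t \<circ> f))"
proof -
  let ?g = "Transposition.transpose s t \<circ> f"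
  have perm_f: "permutation f"
    using assms(1,2) permutes_imp_permutation by blast
  have perm_g: "permutation ?g"
    by (intro permutation_compose permutation_swap_id perm_f)
  note self = permutation_self_in_orbit[OF perm_f] permutation_self_in_orbit[OF perm_g]
  note orbit_eq = orbit_eq_if_mem_orbit[OF perm_f] orbit_eq_if_mem_orbit[OF perm_g]
  define Y where "Y = X - (orbit f s \<union> orbit f t)"
  have X: "X = orbit f s \<union> orbit f t \<union> Y"
    using permutes_orbit_subset[OF assms(1)] assms(3,4) by (auto simp: Y_def)
  have s_notin: "s \<notin> orbit f t" using assms(5) orbit_eq self by metis
  have Y_notin: "s \<notin> orbit f x" "t \<notin> orbit f x" if "x \<in> Y" for x
    using that orbit_eq self by (auto simp: Y_def)
  have g_s: "orbit ?g s = orbit f s \<union> orbit f t"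
    by (rule orbit_transpose_comp[OF perm_f assms(5)])
  have "orbit f ` orbit f x = {orbit f x}" for x using orbit_eq self by blast
  then have "orbit f ` X = {orbit f s, orbit f t} \<union> orbit f ` Y"
    by (subst X) (simp add: image_Un insert_commute)
  moreover have "orbit ?g ` X = {orbit f s \<union> orbit f t} \<union> orbit f ` Y"
  proof -
    have "orbit ?g ` orbit ?g s = {orbit ?g s}" using orbit_eq self by blast
    moreover have "orbit ?g ` Y = orbit f ` Y"
      using orbit_transpose_comp_other[OF perm_f Y_notin] by (intro image_cong) auto
    ultimately have "orbit ?g ` (orbit ?g s \<union> Y) = {orbit ?g s} \<union> orbit f ` Y"
      by (simp only: image_Un)
    then show ?thesis unfolding g_s X[symmetric] .
  qed
  moreover have "orbit f s \<noteq> orbit f t" "orbit f s \<notin> orbit f ` Y" "orbit f t \<notin> orbit f ` Y"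
    "orbit f s \<union> orbit f t \<notin> orbit f ` Y"
    using Y_notin self s_notin by blast+
  moreover have "finite (orbit f ` Y)" using assms(2) by (simp add: Y_def)
  ultimately show ?thesis by (simp add: num_cycles_def)
qed

lemma num_cycles_cong:
  assumes "f ` S \<subseteq> S" "\<And>x. x \<in> S \<Longrightarrow> g x = f x"
  shows "num_cycles S g = num_cycles S f"
proof -
  have "orbit g x = orbit f x" if "x \<in> S" for x
    by (rule orbit_cong0[OF that]) (use assms in auto)
  then show ?thesis unfolding num_cycles_def by (metis (mono_tags, lifting) image_cong)
qed

lemma num_cycles_restrict_id:
  "f ` S \<subseteq> S \<Longrightarrow> num_cycles S (restrict_id f S) = num_cycles S f"
  by (rule num_cycles_cong) auto

lemma num_cycles_pos:
  assumes "finite S" "S \<noteq> {}"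
  shows "0 < num_cycles S f"
  using assms by (simp add: num_cycles_def card_gt_0_iff)

lemma num_cycles_Un:
  assumes "permutation f" "f ` S \<subseteq> S" "S \<inter> U = {}" "finite S" "finite U"
  shows "num_cycles (S \<union> U) f = num_cycles S f + num_cycles U f"
proof -
  have "orbit f x \<subseteq> S" if "x \<in> S" for x
    by (rule orbit_subset_if_closed[OF that]) (use assms(2) in auto)
  then have "orbit f ` S \<inter> orbit f ` U = {}"
    using assms(3) permutation_self_in_orbit[OF assms(1)] by fast
  then show ?thesis
    using assms by (simp add: num_cycles_def image_Un card_Un_disjoint)
qed

lemma num_cycles_conj:
  assumes "finite X" "t permutes X" "g permutes X"
  shows "num_cycles X (t \<circ> g \<circ> inv t) = num_cycles X g"
proof -
  have "t ` orbit g x = orbit (t \<circ> g \<circ> inv t) (t x)" for x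
    by (intro orbit_inverse permutation_self_in_orbit permutes_imp_permutation[OF assms(1,3)])
      (simp add: permutes_inverses[OF assms(2)])
  then have "image t ` (orbit g ` X) = orbit (t \<circ> g \<circ> inv t) ` (t ` X)"
    by (simp only: image_image)
  then have "orbit (t \<circ> g \<circ> inv t) ` X = image t ` (orbit g ` X)"
    using permutes_image[OF assms(2)] by simp
  moreover have "inj_on (image t) (orbit g ` X)"
    by (rule inj_onI) (simp add: inj_image_eq_iff[OF permutes_inj[OF assms(2)]])
  ultimately show ?thesis unfolding num_cycles_def by (metis card_image)
qed

lemma num_cycles_transpose_comp_insert:
  assumes "finite S" "a \<notin> S" "f permutes S" "b \<in> insert a S"
  shows "num_cycles (insert a S) (Transposition.transpose a b \<circ> f)
    = num_cycles S f + (if b = a then 1 else 0)"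
proof -
  have "permutation f" using assms permutes_imp_permutation by blast
  then have "num_cycles (S \<union> {a}) f = num_cycles S f + num_cycles {a} f"
    by (rule num_cycles_Un) (use assms permutes_image in auto)
  then have fixed_point: "num_cycles (insert a S) f = Suc (num_cycles S f)"
    by (simp add: num_cycles_def)
  show ?thesis
  proof (cases "b = a")
    case False
    have f: "f permutes insert a S" using assms(3) by (rule permutes_subset) auto
    have "orbit f a = {a}" using assms permutes_not_in orbit_eq_singleton_iff by metis
    then have "num_cycles (insert a S) f
      = Suc (num_cycles (insert a S) (Transposition.transpose a b \<circ> f))"
      using False assms by (intro num_cycles_transpose_comp[OF f]) auto
    then show ?thesis using False fixed_point by simp
  qed (use fixed_point in simp)
qed

lemma sign_eq_num_cycles:
  assumes "finite S" "p permutes S"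
  shows "sign p = (-1) ^ (card S + num_cycles S p)"
  using assms
proof (induction S arbitrary: p)
  case empty
  then show ?case by (simp add: num_cycles_def)
next
  case (insert a S)
  obtain b q where p: "p = Transposition.transpose a b \<circ> q" and b: "b \<in> insert a S"
    and q: "q permutes S"
    using insert.prems permutes_insert[of a S] by fast
  have "sign p = sign (Transposition.transpose a b) * sign q"
    unfolding p
    by (intro sign_compose permutation_swap_id permutes_imp_permutation[OF insert(1) q])
  then show ?case
    using num_cycles_transpose_comp_insert[OF insert(1,2) q b, folded p]
      insert.IH[OF q] insert(1,2)
    by (cases "a = b") (simp_all add: sign_swap_id)
qed

text \<open>Lowering the exponent instead of dividing by \<open>z\<close> keeps the case \<open>z = 0\<close>.\<close>

lemma sum_permutes_power_num_cycles_minus_one: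
  fixes z :: "'b :: comm_ring_1"
  assumes "finite S" "S \<noteq> {}"
  shows "(\<Sum>p | p permutes S. z ^ (num_cycles S p - 1)) = pochhammer (z + 1) (card S - 1)"
  using assms
proof (induction rule: finite_ne_induct)
  case (singleton a)
  then show ?case by (simp add: num_cycles_def)
next
  case (insert a S)
  have "(\<Sum>p | p permutes insert a S. z ^ (num_cycles (insert a S) p - 1))
    = (\<Sum>b\<in>insert a S. \<Sum>q | q permutes S.
        z ^ (num_cycles (insert a S) (Transposition.transpose a b \<circ> q) - 1))"
    by (rule sum_over_permutations_insert[OF insert(1,3)])
  also have "\<dots> = (\<Sum>b\<in>insert a S. \<Sum>q | q permutes S.
      (if b = a then z else 1) * z ^ (num_cycles S q - 1))"
  proof (intro sum.cong refl)
    fix b q assume "b \<in> insert a S" "q \<in> {q. q permutes S}"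
    then have "num_cycles (insert a S) (Transposition.transpose a b \<circ> q) - 1
      = (if b = a then Suc (num_cycles S q - 1) else num_cycles S q - 1)"
      using num_cycles_transpose_comp_insert[OF insert(1,3), of q b]
        num_cycles_pos[OF insert(1,2), of q] by simp
    then show "z ^ (num_cycles (insert a S) (Transposition.transpose a b \<circ> q) - 1)
      = (if b = a then z else 1) * z ^ (num_cycles S q - 1)" by simp
  qed
  also have "\<dots> = (\<Sum>b\<in>insert a S. if b = a then z else 1) * pochhammer (z + 1) (card S - 1)"
    by (simp only: insert.IH flip: sum_distrib_left sum_distrib_right)
  also have "(\<Sum>b\<in>insert a S. if b = a then z else 1) = z + of_nat (card S)"
  proof -
    have "(\<Sum>b\<in>S. if b = a then z else 1) = (\<Sum>b\<in>S. 1)"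
      using insert(3) by (intro sum.cong) auto
    then show ?thesis using insert(1,3) by simp
  qed
  also have "(z + of_nat (card S)) * pochhammer (z + 1) (card S - 1) = pochhammer (z + 1) (card S)"
    using insert(1,2) by (cases "card S") (simp_all add: pochhammer_Suc algebra_simps)
  finally show ?case using insert(1,3) by simp
qed

lemma sum_permutes_power_num_cycles:
  fixes z :: "'b :: comm_ring_1"
  assumes "finite S"
  shows "(\<Sum>p | p permutes S. z ^ num_cycles S p) = pochhammer z (card S)"
proof (cases "S = {}")
  case False
  then obtain m where m: "card S = Suc m" using assms by (cases "card S") auto
  have "z ^ num_cycles S p = z * z ^ (num_cycles S p - 1)" for p
    using num_cycles_pos[OF assms False, of p] by (simp flip: power_Suc)
  then have "(\<Sum>p | p permutes S. z ^ num_cycles S p) = z * pochhammer (z + 1) m"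
    using sum_permutes_power_num_cycles_minus_one[OF assms False, of z] m
    by (simp flip: sum_distrib_left)
  then show ?thesis by (simp add: m pochhammer_rec)
qed (simp add: num_cycles_def)

lemma sum_permutes_sign_power_num_cycles:
  fixes z :: "'b :: comm_ring_1"
  assumes "finite S"
  shows "(\<Sum>p | p permutes S. of_int (sign p) * z ^ num_cycles S p)
    = (-1) ^ card S * pochhammer (- z) (card S)"
proof -
  have "(\<Sum>p | p permutes S. of_int (sign p) * z ^ num_cycles S p)
    = (\<Sum>p | p permutes S. (-1) ^ card S * (- z) ^ num_cycles S p)"
  proof (intro sum.cong refl)
    fix p assume "p \<in> {p. p permutes S}"
    then have "sign p = (-1) ^ card S * (-1) ^ num_cycles S p"
      using sign_eq_num_cycles[OF assms] by (simp add: power_add)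
    then show "of_int (sign p) * z ^ num_cycles S p = (-1) ^ card S * (- z) ^ num_cycles S p"
      unfolding power_minus[of z] by (simp add: mult.assoc)
  qed
  then show ?thesis
    by (simp only: sum_permutes_power_num_cycles[OF assms] flip: sum_distrib_left)
qed

lemma sum_permutes_sign_power_num_cycles_minus_one:
  fixes z :: "'b :: comm_ring_1"
  assumes "finite S" "S \<noteq> {}"
  shows "(\<Sum>p | p permutes S. of_int (sign p) * z ^ (num_cycles S p - 1))
    = (-1) ^ (card S - 1) * pochhammer (1 - z) (card S - 1)"
proof -
  have "(\<Sum>p | p permutes S. of_int (sign p) * z ^ (num_cycles S p - 1))
    = (\<Sum>p | p permutes S. (-1) ^ (card S - 1) * (- z) ^ (num_cycles S p - 1))"
  proof (intro sum.cong refl)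
    fix p assume p: "p \<in> {p. p permutes S}"
    have "card S + num_cycles S p = card S - 1 + (num_cycles S p - 1) + 2"
      using num_cycles_pos[OF assms, of p] card_gt_0_iff[of S] assms by simp
    then have "sign p = (-1) ^ (card S - 1 + (num_cycles S p - 1) + 2)"
      using sign_eq_num_cycles[OF assms(1), of p] p by (simp only: mem_Collect_eq)
    then have "sign p = (-1) ^ (card S - 1) * (-1) ^ (num_cycles S p - 1)"
      by (simp only: power_add) simp
    then show "of_int (sign p) * z ^ (num_cycles S p - 1)
      = (-1) ^ (card S - 1) * (- z) ^ (num_cycles S p - 1)"
      unfolding power_minus[of z] by (simp add: mult.assoc)
  qed
  then show ?thesis
    using sum_permutes_power_num_cycles_minus_one[OF assms, of "- z"]
    by (simp flip: sum_distrib_left)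
qed

section \<open>Invariant subsets\<close>

definition invariant_subsets :: "('a \<Rightarrow> 'a) \<Rightarrow> 'a set \<Rightarrow> 'a set set" where
  "invariant_subsets f X = {S. S \<subseteq> X \<and> f ` S = S}"

lemma image_orbit:
  assumes "permutation f"
  shows "f ` orbit f x = orbit f x"
proof
  show "f ` orbit f x \<subseteq> orbit f x" by (auto intro: orbit.step)
  show "orbit f x \<subseteq> f ` orbit f x"
    using permutation_self_in_orbit[OF assms] by (auto elim: orbit.cases)
qed

lemma Union_orbits_eq:
  assumes "permutation f" "f ` S = S"
  shows "\<Union> (orbit f ` S) = S"
proof -
  have "orbit f x \<subseteq> S" if "x \<in> S" for x
    by (rule orbit_subset_if_closed[OF that]) (use assms(2) in auto)
  then show ?thesis using permutation_self_in_orbit[OF assms(1)] by blast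
qed

lemma image_orbit_Union:
  assumes "permutation f" "A \<subseteq> orbit f ` X"
  shows "orbit f ` \<Union> A = A"
proof -
  have "orbit f ` C = {C}" if "C \<in> A" for C
  proof -
    obtain x where "C = orbit f x" using \<open>C \<in> A\<close> assms(2) by blast
    then show ?thesis
      using orbit_eq_if_mem_orbit[OF assms(1)] permutation_self_in_orbit[OF assms(1)] by blast
  qed
  then have "orbit f ` \<Union> A = (\<Union>C\<in>A. {C})" by (simp add: image_Union)
  then show ?thesis by simp
qed

lemma bij_betw_Union_invariant_subsets:
  assumes "permutation f" "f ` X = X"
  shows "bij_betw Union (Pow (orbit f ` X)) (invariant_subsets f X)"
proof (rule bij_betw_byWitness[where f' = "image (orbit f)"])
  show "\<forall>A\<in>Pow (orbit f ` X). orbit f ` \<Union> A = A"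
    using image_orbit_Union[OF assms(1)] by blast
  show "\<forall>S\<in>invariant_subsets f X. \<Union> (orbit f ` S) = S"
    using Union_orbits_eq[OF assms(1)] by (simp add: invariant_subsets_def)
  show "image (orbit f) ` invariant_subsets f X \<subseteq> Pow (orbit f ` X)"
    by (auto simp: invariant_subsets_def)
  show "Union ` Pow (orbit f ` X) \<subseteq> invariant_subsets f X"
  proof clarify
    fix A assume A: "A \<subseteq> orbit f ` X"
    then have "f ` C = C" if "C \<in> A" for C using that image_orbit[OF assms(1)] by auto
    then have "f ` \<Union> A = \<Union> A" by (simp add: image_Union)
    moreover have "\<Union> A \<subseteq> X" using A Union_orbits_eq[OF assms] by blast
    ultimately show "\<Union> A \<in> invariant_subsets f X" by (simp add: invariant_subsets_def)
  qed
qed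

lemma finite_invariant_subsets: "finite X \<Longrightarrow> finite (invariant_subsets f X)"
  by (simp add: invariant_subsets_def)

lemma sum_alternating_supersets:
  assumes "finite A" "U \<subseteq> A"
  shows "(\<Sum>T | T \<subseteq> A \<and> U \<subseteq> T. (-1 :: 'b :: ring_1) ^ card T) = (if U = A then (-1) ^ card A else 0)"
proof (cases "U = A")
  case True
  then have "{T. T \<subseteq> A \<and> U \<subseteq> T} = {A}" by auto
  then show ?thesis using True by simp
next
  case False
  then have "U \<subset> A" using assms(2) by blast
  from card_subsupersets_even_odd[OF assms(1) this] show ?thesis
    using False assms(1) by (subst sum_alternating_cancels) (simp_all add: conj_assoc)
qed

lemma cyclic_on_iff_image_orbit:
  assumes "permutation f" "f ` X = X" "x \<in> X"
  shows "cyclic_on f X \<longleftrightarrow> orbit f ` X = {orbit f x}"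
proof
  assume "orbit f ` X = {orbit f x}"
  then have "X = orbit f x" using Union_orbits_eq[OF assms(1,2)] by simp
  then show "cyclic_on f X" using assms(3) by (rule cyclic_on_singleI[rotated])
next
  assume "cyclic_on f X"
  then have "orbit f y = X" if "y \<in> X" for y using that orbit_cyclic_eq3 by fast
  then show "orbit f ` X = {orbit f x}" using assms(3) by auto
qed

lemma sum_invariant_subsets_containing:
  assumes "permutation f" "f ` X = X" "finite X" "x \<in> X"
  shows "(\<Sum>S | S \<in> invariant_subsets f X \<and> x \<in> S. (-1 :: 'b :: ring_1) ^ num_cycles S f)
    = (if cyclic_on f X then - 1 else 0)"
proof -
  let ?O = "orbit f ` X"
  have "x \<in> \<Union> A \<longleftrightarrow> orbit f x \<in> A" if A: "A \<in> Pow ?O" for A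
  proof
    assume "x \<in> \<Union> A"
    then obtain C where C: "C \<in> A" "x \<in> C" by blast
    then obtain z where "C = orbit f z" using A by blast
    then show "orbit f x \<in> A" using C orbit_eq_if_mem_orbit[OF assms(1)] by simp
  qed (use permutation_self_in_orbit[OF assms(1)] in blast)
  with bij_betw_Union_invariant_subsets[OF assms(1,2)]
  have bij: "bij_betw Union {A \<in> Pow ?O. orbit f x \<in> A} {S \<in> invariant_subsets f X. x \<in> S}"
    by (rule bij_betw_Collect)
  have "(\<Sum>S | S \<in> invariant_subsets f X \<and> x \<in> S. (-1 :: 'b) ^ num_cycles S f)
    = (\<Sum>A | A \<in> Pow ?O \<and> orbit f x \<in> A. (-1) ^ num_cycles (\<Union> A) f)"
    by (rule sum.reindex_bij_betw[OF bij, symmetric])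
  also have "\<dots> = (\<Sum>A | A \<subseteq> ?O \<and> {orbit f x} \<subseteq> A. (-1) ^ card A)"
    by (intro sum.cong) (auto simp: num_cycles_def image_orbit_Union[OF assms(1)])
  also have "\<dots> = (if {orbit f x} = ?O then (-1) ^ card ?O else 0)"
    by (rule sum_alternating_supersets) (use assms in auto)
  also have "\<dots> = (if cyclic_on f X then - 1 else 0)"
    unfolding cyclic_on_iff_image_orbit[OF assms(1,2,4)] by auto
  finally show ?thesis .
qed

lemma sum_invariant_subsets_card:
  assumes "permutation f" "f ` X = X" "finite X"
  shows "(\<Sum>S\<in>invariant_subsets f X. of_nat (card S) * (-1) ^ num_cycles S f)
    = (if cyclic_on f X then - of_nat (card X) else 0 :: 'b :: ring_1)"
proof -
  have "(\<Sum>S\<in>invariant_subsets f X. of_nat (card S) * (-1 :: 'b) ^ num_cycles S f)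
    = (\<Sum>S\<in>invariant_subsets f X. \<Sum>x | x \<in> X \<and> x \<in> S. (-1) ^ num_cycles S f)"
  proof (intro sum.cong refl)
    fix S assume "S \<in> invariant_subsets f X"
    then have "{x. x \<in> X \<and> x \<in> S} = S" by (auto simp: invariant_subsets_def)
    then show "of_nat (card S) * (-1 :: 'b) ^ num_cycles S f
      = (\<Sum>x | x \<in> X \<and> x \<in> S. (-1) ^ num_cycles S f)"
      by simp
  qed
  also have "\<dots> = (\<Sum>x\<in>X. \<Sum>S | S \<in> invariant_subsets f X \<and> x \<in> S. (-1) ^ num_cycles S f)"
    by (rule sum.swap_restrict) (use assms(3) finite_invariant_subsets in auto)
  also have "\<dots> = (\<Sum>x\<in>X. if cyclic_on f X then - 1 else 0)"
    by (intro sum.cong refl sum_invariant_subsets_containing assms)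
  finally show ?thesis by simp
qed

section \<open>Fixed-point-free involutions\<close>

lemma fpf_involutionD:
  assumes "a \<in> fpf_involutions X"
  shows "a permutes X" "a (a x) = x" "x \<in> X \<Longrightarrow> a x \<noteq> x"
proof -
  show a: "a permutes X" using assms by (simp add: fpf_involutions_def)
  show "a (a x) = x"
    using assms permutes_not_in[OF a] by (cases "x \<in> X") (auto simp: fpf_involutions_def)
  show "x \<in> X \<Longrightarrow> a x \<noteq> x" using assms by (auto simp: fpf_involutions_def)
qed

lemma image_involution_eq:
  assumes "\<And>x. a (a x) = x" "\<And>x. x \<in> S \<Longrightarrow> a x \<in> S"
  shows "a ` S = S"
  using assms by (metis image_eqI image_subsetI subsetI subset_antisym)

lemma fpf_involutions_nonempty:
  assumes "finite X" "even (card X)"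
  shows "fpf_involutions X \<noteq> {}"
proof -
  obtain n where "card X = 2 * n" using assms(2) by (elim evenE)
  with assms(1) show ?thesis
  proof (induction n arbitrary: X)
    case 0
    then have "id \<in> fpf_involutions X" by (simp add: fpf_involutions_def permutes_id)
    then show ?case by blast
  next
    case (Suc n)
    then have "card X = Suc (Suc (2 * n))" by simp
    then obtain s t Y where X: "X = insert s (insert t Y)" "s \<notin> insert t Y" "t \<notin> Y" "card Y = 2 * n"
      by (auto simp: card_Suc_eq)
    then obtain a where a: "a \<in> fpf_involutions Y" using Suc by fastforce
    note aD = fpf_involutionD[OF a]
    have "Transposition.transpose s t \<circ> a \<in> fpf_involutions X"
      unfolding fpf_involutions_def
    proof (intro CollectI conjI ballI)
      have "a permutes X" "Transposition.transpose s t permutes X"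
        using X(1) by (auto intro!: permutes_swap_id permutes_subset[OF aD(1)])
      then show "Transposition.transpose s t \<circ> a permutes X" by (intro permutes_compose)
      fix i assume i: "i \<in> X"
      consider "i = s" | "i = t" | "i \<in> Y" "a i \<in> Y" "i \<noteq> s" "i \<noteq> t" "a i \<noteq> s" "a i \<noteq> t"
        using i X permutes_in_image[OF aD(1)] by auto
      then have "(Transposition.transpose s t \<circ> a) ((Transposition.transpose s t \<circ> a) i) = i
        \<and> (Transposition.transpose s t \<circ> a) i \<noteq> i"
        by cases (use X permutes_not_in[OF aD(1)] aD(2,3) in auto)
      then show "(Transposition.transpose s t \<circ> a) ((Transposition.transpose s t \<circ> a) i) = i"
        "(Transposition.transpose s t \<circ> a) i \<noteq> i"
        by blast+
    qed
    then show ?case by blast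
  qed
qed

lemma card_invariant_fpf_involution:
  assumes "a \<in> fpf_involutions X" "finite X" "S \<in> invariant_subsets a X"
  shows "card S = 2 * num_cycles S a"
proof -
  note a = fpf_involutionD[OF assms(1)]
  have perm: "permutation a" using a(1) assms(2) permutes_imp_permutation by blast
  have S: "S \<subseteq> X" "a ` S = S" using assms(3) by (auto simp: invariant_subsets_def)
  have "orbit a x = {x, a x}" for x
  proof
    show "orbit a x \<subseteq> {x, a x}" by (rule orbit_subset_if_closed) (auto simp: a(2))
    show "{x, a x} \<subseteq> orbit a x" using orbit.base permutation_self_in_orbit[OF perm] by fast
  qed
  then have "card C = 2" if "C \<in> orbit a ` S" for C
    using that S(1) a(3) by (metis card_2_iff imageE subsetD)
  moreover have "C \<inter> D = {}" if "C \<in> orbit a ` S" "D \<in> orbit a ` S" "C \<noteq> D" for C D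
    using that orbit_eq_if_mem_orbit[OF perm] by blast
  moreover have "finite S" using S(1) assms(2) by (rule finite_subset)
  ultimately have "2 * card (orbit a ` S) = card (\<Union> (orbit a ` S))"
    by (intro card_partition) (simp_all add: Union_orbits_eq[OF perm S(2)])
  then show ?thesis by (simp add: num_cycles_def Union_orbits_eq[OF perm S(2)])
qed

lemma card_invariant_subsets_fpf_involution:
  assumes "a \<in> fpf_involutions X" "finite X" "Y \<in> invariant_subsets a X"
  shows "card {S \<in> invariant_subsets a Y. card S = 2 * j} = (card Y div 2) choose j"
proof -
  have perm: "permutation a"
    using fpf_involutionD(1)[OF assms(1)] assms(2) permutes_imp_permutation by blast
  have Y: "Y \<subseteq> X" "a ` Y = Y" using assms(3) by (auto simp: invariant_subsets_def)
  let ?O = "orbit a ` Y"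
  note bij = bij_betw_Union_invariant_subsets[OF perm Y(2)]
  have "card (\<Union> A) = 2 * j \<longleftrightarrow> card A = j" if A: "A \<in> Pow ?O" for A
  proof -
    have "\<Union> A \<in> invariant_subsets a Y" using bij_betwE[OF bij] A by blast
    then have "\<Union> A \<in> invariant_subsets a X" using Y(1) by (auto simp: invariant_subsets_def)
    then show ?thesis
      using card_invariant_fpf_involution[OF assms(1,2)] image_orbit_Union[OF perm, of A Y] A
      by (simp add: num_cycles_def)
  qed
  with bij have
    "bij_betw Union {A \<in> Pow ?O. card A = j} {S \<in> invariant_subsets a Y. card S = 2 * j}"
    by (rule bij_betw_Collect)
  then have "card {A \<in> Pow ?O. card A = j} = card {S \<in> invariant_subsets a Y. card S = 2 * j}"
    by (rule bij_betw_same_card)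
  moreover have "card {A \<in> Pow ?O. card A = j} = card ?O choose j"
    using n_subsets[of ?O j] finite_subset[OF Y(1) assms(2)] by simp
  moreover have "card ?O = card Y div 2"
    using card_invariant_fpf_involution[OF assms] by (simp add: num_cycles_def)
  ultimately show ?thesis by simp
qed

definition exit_points :: "('a \<Rightarrow> 'a) \<Rightarrow> 'a set \<Rightarrow> 'a set" where
  "exit_points a S = {s \<in> S. a s \<notin> S}"

lemma exit_points_empty_iff:
  assumes "a \<in> fpf_involutions X" "S \<subseteq> X"
  shows "exit_points a S = {} \<longleftrightarrow> S \<in> invariant_subsets a X"
proof
  assume "exit_points a S = {}"
  then have "a x \<in> S" if "x \<in> S" for x using that by (auto simp: exit_points_def)
  then have "a ` S = S" by (rule image_involution_eq[OF fpf_involutionD(2)[OF assms(1)]])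
  then show "S \<in> invariant_subsets a X" using assms(2) by (simp add: invariant_subsets_def)
qed (auto simp: exit_points_def invariant_subsets_def)

lemma invariant_subsets_Diff_exit_point:
  assumes "a \<in> fpf_involutions X" "S \<subseteq> X" "exit_points a S = {s}"
  shows "S - {s} \<in> invariant_subsets a (X - {s, a s})"
proof -
  note involution = fpf_involutionD(2)[OF assms(1)]
  have "a s \<notin> S" using assms(3) by (auto simp: exit_points_def)
  have "a x \<in> S - {s}" if "x \<in> S - {s}" for x
  proof -
    have "a x \<in> S" using that assms(3) by (auto simp: exit_points_def)
    moreover have "a x \<noteq> s" using that \<open>a s \<notin> S\<close> involution[of x] by auto
    ultimately show ?thesis by simp
  qed
  then have "a ` (S - {s}) = S - {s}" by (rule image_involution_eq[OF involution])
  then show ?thesis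
    using assms(2) \<open>a s \<notin> S\<close> by (auto simp: invariant_subsets_def)
qed

lemma bij_betw_insert_exit_point:
  assumes "a \<in> fpf_involutions X" "s \<in> X"
  shows "bij_betw (insert s) (invariant_subsets a (X - {s, a s}))
    {S. S \<subseteq> X \<and> exit_points a S = {s}}"
proof (rule bij_betw_byWitness[where f' = "\<lambda>S. S - {s}"])
  show "\<forall>P\<in>invariant_subsets a (X - {s, a s}). insert s P - {s} = P"
    by (auto simp: invariant_subsets_def)
  show "\<forall>S\<in>{S. S \<subseteq> X \<and> exit_points a S = {s}}. insert s (S - {s}) = S"
    by (auto simp: exit_points_def)
  show "insert s ` invariant_subsets a (X - {s, a s}) \<subseteq> {S. S \<subseteq> X \<and> exit_points a S = {s}}"
    using assms(2) fpf_involutionD(3)[OF assms]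
    by (auto simp: exit_points_def invariant_subsets_def)
  show "(\<lambda>S. S - {s}) ` {S. S \<subseteq> X \<and> exit_points a S = {s}} \<subseteq> invariant_subsets a (X - {s, a s})"
    using invariant_subsets_Diff_exit_point[OF assms(1)] by blast
qed

section \<open>Signed sums over set stabilizers\<close>

definition set_stabilizer :: "'a set \<Rightarrow> 'a set \<Rightarrow> ('a \<Rightarrow> 'a) set" where
  "set_stabilizer X S = {b. b permutes X \<and> b ` S = S}"

definition signed_stabilizer_sum :: "'a set \<Rightarrow> 'a set \<Rightarrow> (('a \<Rightarrow> 'a) \<Rightarrow> 'b :: comm_ring_1) \<Rightarrow> 'b" where
  "signed_stabilizer_sum X S h = (\<Sum>b\<in>set_stabilizer X S. of_int (sign_on S b) * h b)"

lemma set_stabilizer_image_Diff: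
  assumes "b \<in> set_stabilizer X S"
  shows "b ` (X - S) = X - S"
  using assms permutes_image[of b X] permutes_inj[of b X]
  by (simp add: set_stabilizer_def image_set_diff)

lemma set_stabilizer_comp:
  assumes "b \<in> set_stabilizer X S" "c \<in> set_stabilizer X S"
  shows "b \<circ> c \<in> set_stabilizer X S"
proof -
  have "(b \<circ> c) ` S = S"
    unfolding image_comp[symmetric] using assms by (simp add: set_stabilizer_def)
  then show ?thesis using assms by (simp add: set_stabilizer_def permutes_compose)
qed

lemma set_stabilizer_inv:
  assumes "b \<in> set_stabilizer X S"
  shows "inv b \<in> set_stabilizer X S"
proof -
  have "b permutes X" "b ` S = S" using assms by (auto simp: set_stabilizer_def)
  then show ?thesis
    using image_inv_f_f[OF permutes_inj, of b X S] permutes_inv[of b X]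
    by (simp add: set_stabilizer_def)
qed

lemma bij_betw_set_stabilizer_translate:
  assumes "c \<in> set_stabilizer X S" "d \<in> set_stabilizer X S"
  shows "bij_betw (\<lambda>b. c \<circ> b \<circ> d) (set_stabilizer X S) (set_stabilizer X S)"
proof (rule bij_betw_byWitness[where f' = "\<lambda>b. inv c \<circ> b \<circ> inv d"])
  have "c permutes X" "d permutes X" using assms by (auto simp: set_stabilizer_def)
  then have "inv c \<circ> (c \<circ> b \<circ> d) \<circ> inv d = b" "c \<circ> (inv c \<circ> b \<circ> inv d) \<circ> d = b" for b
    by (auto simp: fun_eq_iff permutes_inverses)
  then show "\<forall>b\<in>set_stabilizer X S. inv c \<circ> (c \<circ> b \<circ> d) \<circ> inv d = b"
    "\<forall>b\<in>set_stabilizer X S. c \<circ> (inv c \<circ> b \<circ> inv d) \<circ> d = b"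
    by blast+
qed (use assms set_stabilizer_comp set_stabilizer_inv in blast)+

lemma transpose_in_set_stabilizer:
  assumes "S \<subseteq> X" "{s, t} \<subseteq> S \<or> {s, t} \<subseteq> X - S"
  shows "Transposition.transpose s t \<in> set_stabilizer X S"
proof -
  have "Transposition.transpose s t permutes X" using assms by (intro permutes_swap_id) auto
  moreover have "Transposition.transpose s t ` S = S"
    by (rule image_involution_eq) (use assms in \<open>auto simp: Transposition.transpose_def\<close>)
  ultimately show ?thesis by (simp add: set_stabilizer_def)
qed

lemma set_stabilizer_bij_betw:
  assumes "b \<in> set_stabilizer X S"
  shows "bij_betw b S S" "bij_betw b (X - S) (X - S)"
  using assms set_stabilizer_image_Diff[OF assms] permutes_inj_on[of b X]
  by (auto simp: set_stabilizer_def bij_betw_def)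

lemma restrict_id_comp_set_stabilizer:
  assumes "S \<subseteq> X" "b \<in> set_stabilizer X S"
  shows "restrict_id b S \<circ> restrict_id b (X - S) = b"
proof
  fix x
  consider "x \<in> S" | "x \<in> X - S" "b x \<in> X - S" | "x \<notin> X"
    using set_stabilizer_image_Diff[OF assms(2)] by blast
  then show "(restrict_id b S \<circ> restrict_id b (X - S)) x = b x"
    by cases
      (use assms permutes_not_in[of b X x] in \<open>auto simp: set_stabilizer_def restrict_id_def\<close>)
qed

lemma bij_betw_set_stabilizer_restrict:
  assumes "S \<subseteq> X"
  shows "bij_betw (\<lambda>b. (restrict_id b S, restrict_id b (X - S))) (set_stabilizer X S)
    ({p. p permutes S} \<times> {q. q permutes X - S})"
proof (rule bij_betw_byWitness[where f' = "\<lambda>(p, q). p \<circ> q"])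
  show "\<forall>b\<in>set_stabilizer X S.
    (case (restrict_id b S, restrict_id b (X - S)) of (p, q) \<Rightarrow> p \<circ> q) = b"
    using restrict_id_comp_set_stabilizer[OF assms] by simp
  show "\<forall>z\<in>{p. p permutes S} \<times> {q. q permutes X - S}.
    (restrict_id (case z of (p, q) \<Rightarrow> p \<circ> q) S, restrict_id (case z of (p, q) \<Rightarrow> p \<circ> q) (X - S)) = z"
  proof clarify
    fix p q assume p: "p permutes S" and q: "q permutes X - S"
    show "restrict_id (p \<circ> q) S = p \<and> restrict_id (p \<circ> q) (X - S) = q"
      using permutes_not_in[OF p] permutes_not_in[OF q] permutes_in_image[OF q]
      by (auto simp: restrict_id_def fun_eq_iff)
  qed
  show "(\<lambda>b. (restrict_id b S, restrict_id b (X - S))) ` set_stabilizer X S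
    \<subseteq> {p. p permutes S} \<times> {q. q permutes X - S}"
    using set_stabilizer_bij_betw by (blast intro: permutes_restrict_id)
  show "(\<lambda>(p, q). p \<circ> q) ` ({p. p permutes S} \<times> {q. q permutes X - S}) \<subseteq> set_stabilizer X S"
  proof clarify
    fix p q assume p: "p permutes S" and q: "q permutes X - S"
    have "p permutes X" "q permutes X"
      using permutes_subset[OF p assms] permutes_subset[OF q Diff_subset] .
    moreover have "(p \<circ> q) ` S = p ` S"
      using permutes_not_in[OF q] by (intro image_cong) auto
    ultimately show "p \<circ> q \<in> set_stabilizer X S"
      using permutes_image[OF p] by (simp add: set_stabilizer_def permutes_compose)
  qed
qed

lemma signed_stabilizer_sum_translate:
  assumes "finite S" "c \<in> set_stabilizer X S" "d \<in> set_stabilizer X S"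
  shows "signed_stabilizer_sum X S (\<lambda>b. h (c \<circ> b \<circ> d))
    = of_int (sign_on S c * sign_on S d) * signed_stabilizer_sum X S h"
proof -
  let ?G = "set_stabilizer X S"
  from bij_betw_set_stabilizer_translate[OF assms(2,3)]
  have "signed_stabilizer_sum X S h
    = (\<Sum>b\<in>?G. of_int (sign_on S (c \<circ> b \<circ> d)) * h (c \<circ> b \<circ> d))"
    unfolding signed_stabilizer_sum_def by (rule sum.reindex_bij_betw[symmetric])
  also have "\<dots>
    = (\<Sum>b\<in>?G. of_int (sign_on S c * sign_on S d) * (of_int (sign_on S b) * h (c \<circ> b \<circ> d)))"
  proof (intro sum.cong refl)
    fix b assume "b \<in> ?G"
    then have "sign_on S (c \<circ> b \<circ> d) = sign_on S c * sign_on S b * sign_on S d"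
      by (metis assms set_stabilizer_bij_betw(1) set_stabilizer_comp sign_on_compose)
    then show "of_int (sign_on S (c \<circ> b \<circ> d)) * h (c \<circ> b \<circ> d)
      = of_int (sign_on S c * sign_on S d) * (of_int (sign_on S b) * h (c \<circ> b \<circ> d))"
      by (simp only: of_int_mult ac_simps)
  qed
  also have "\<dots> = of_int (sign_on S c * sign_on S d) * signed_stabilizer_sum X S (\<lambda>b. h (c \<circ> b \<circ> d))"
    by (simp add: signed_stabilizer_sum_def sum_distrib_left)
  finally have "of_int (sign_on S c * sign_on S d) * signed_stabilizer_sum X S h
    = of_int ((sign_on S c * sign_on S d) * (sign_on S c * sign_on S d))
      * signed_stabilizer_sum X S (\<lambda>b. h (c \<circ> b \<circ> d))"
    by (simp only: mult.assoc of_int_mult)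
  then show ?thesis by (simp add: sign_on_def mult.assoc sign_idempotent mult.left_commute)
qed

lemma num_cycles_set_stabilizer:
  assumes "finite X" "S \<subseteq> X" "b \<in> set_stabilizer X S"
  shows "num_cycles X b = num_cycles S b + num_cycles (X - S) b"
proof -
  have "permutation b"
    using assms permutes_imp_permutation by (auto simp: set_stabilizer_def)
  then have "num_cycles (S \<union> (X - S)) b = num_cycles S b + num_cycles (X - S) b"
    by (rule num_cycles_Un) (use assms finite_subset in \<open>auto simp: set_stabilizer_def\<close>)
  then show ?thesis using assms(2) by (simp add: Un_absorb1)
qed

lemma signed_stabilizer_sum_product:
  assumes "S \<subseteq> X"
  shows "signed_stabilizer_sum X S (\<lambda>b. u (num_cycles S b) * v (num_cycles (X - S) b))
    = (\<Sum>p | p permutes S. of_int (sign p) * u (num_cycles S p))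
      * (\<Sum>q | q permutes X - S. v (num_cycles (X - S) q))"
proof -
  let ?H = "\<lambda>(p, q). of_int (sign p) * u (num_cycles S p) * v (num_cycles (X - S) q)"
  have "signed_stabilizer_sum X S (\<lambda>b. u (num_cycles S b) * v (num_cycles (X - S) b))
    = (\<Sum>b\<in>set_stabilizer X S. ?H (restrict_id b S, restrict_id b (X - S)))"
    unfolding signed_stabilizer_sum_def
  proof (intro sum.cong refl)
    fix b assume "b \<in> set_stabilizer X S"
    then have "b ` S \<subseteq> S" "b ` (X - S) \<subseteq> X - S"
      using set_stabilizer_bij_betw[of b X S] by (simp_all add: bij_betw_def)
    then show "of_int (sign_on S b) * (u (num_cycles S b) * v (num_cycles (X - S) b))
      = ?H (restrict_id b S, restrict_id b (X - S))"
      by (simp add: sign_on_def num_cycles_restrict_id mult.assoc)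
  qed
  also have "\<dots> = (\<Sum>z\<in>{p. p permutes S} \<times> {q. q permutes X - S}. ?H z)"
    by (rule sum.reindex_bij_betw[OF bij_betw_set_stabilizer_restrict[OF assms]])
  finally show ?thesis by (simp add: sum_product sum.cartesian_product)
qed

lemma signed_stabilizer_sum_power_num_cycles:
  fixes y :: "'b :: comm_ring_1"
  assumes "finite X" "S \<subseteq> X"
  shows "signed_stabilizer_sum X S (\<lambda>b. y ^ num_cycles X b)
    = (-1) ^ card S * pochhammer (- y) (card S) * pochhammer y (card X - card S)"
proof -
  have fin: "finite S" "finite (X - S)" using assms finite_subset by auto
  have "signed_stabilizer_sum X S (\<lambda>b. y ^ num_cycles X b)
    = signed_stabilizer_sum X S (\<lambda>b. y ^ num_cycles S b * y ^ num_cycles (X - S) b)"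
    unfolding signed_stabilizer_sum_def
    by (intro sum.cong refl) (simp add: num_cycles_set_stabilizer[OF assms] power_add)
  also have "\<dots> = (-1) ^ card S * pochhammer (- y) (card S) * pochhammer y (card (X - S))"
    unfolding signed_stabilizer_sum_product[OF assms(2)]
      sum_permutes_sign_power_num_cycles[OF fin(1)] sum_permutes_power_num_cycles[OF fin(2)] ..
  finally show ?thesis using fin(1) assms(2) by (simp add: card_Diff_subset)
qed

lemma signed_stabilizer_sum_power_num_cycles_minus_one:
  fixes y :: "'b :: comm_ring_1"
  assumes "finite X" "S \<subseteq> X" "S \<noteq> {}"
  shows "signed_stabilizer_sum X S (\<lambda>b. y ^ (num_cycles X b - 1))
    = (-1) ^ (card S - 1) * pochhammer (1 - y) (card S - 1) * pochhammer y (card X - card S)"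
proof -
  have fin: "finite S" "finite (X - S)" using assms finite_subset by auto
  have "signed_stabilizer_sum X S (\<lambda>b. y ^ (num_cycles X b - 1))
    = signed_stabilizer_sum X S (\<lambda>b. y ^ (num_cycles S b - 1) * y ^ num_cycles (X - S) b)"
    unfolding signed_stabilizer_sum_def
  proof (intro sum.cong refl)
    fix b assume "b \<in> set_stabilizer X S"
    then have "num_cycles X b - 1 = (num_cycles S b - 1) + num_cycles (X - S) b"
      using num_cycles_set_stabilizer[OF assms(1,2)] num_cycles_pos[OF fin(1) assms(3), of b]
      by simp
    then show "of_int (sign_on S b) * y ^ (num_cycles X b - 1)
      = of_int (sign_on S b) * (y ^ (num_cycles S b - 1) * y ^ num_cycles (X - S) b)"
      by (simp only: power_add)
  qed
  also have "\<dots>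
    = (-1) ^ (card S - 1) * pochhammer (1 - y) (card S - 1) * pochhammer y (card (X - S))"
    unfolding signed_stabilizer_sum_product[OF assms(2), of "\<lambda>k. y ^ (k - 1)"]
      sum_permutes_sign_power_num_cycles_minus_one[OF fin(1) assms(3)]
      sum_permutes_power_num_cycles[OF fin(2)] ..
  finally show ?thesis using fin(1) assms(2) by (simp add: card_Diff_subset)
qed

lemma sign_on_eq_num_cycles:
  assumes "finite S" "bij_betw f S S"
  shows "sign_on S f = (-1) ^ (card S + num_cycles S f)"
  using sign_eq_num_cycles[OF assms(1) permutes_restrict_id[OF assms(2)]]
    num_cycles_restrict_id[of f S] assms(2)
  by (simp add: sign_on_def bij_betw_imp_surj_on)

lemma sum_full_cycles_conv_invariant_subsets:
  fixes h :: "('a \<Rightarrow> 'a) \<Rightarrow> 'b :: comm_ring_1"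
  assumes "finite X"
  shows "of_nat (card X) * (\<Sum>b\<in>full_cycles X. h b)
    = - (\<Sum>b | b permutes X. \<Sum>S\<in>invariant_subsets b X.
        of_nat (card S) * (-1) ^ num_cycles S b * h b)"
proof -
  let ?P = "{b. b permutes X}"
  have "full_cycles X = {b \<in> ?P. cyclic_on b X}" by (auto simp: full_cycles_def)
  then have "(\<Sum>b\<in>full_cycles X. h b) = (\<Sum>b\<in>?P. if cyclic_on b X then h b else 0)"
    by (simp only: sum.inter_filter[OF finite_permutations[OF assms]])
  then have "of_nat (card X) * (\<Sum>b\<in>full_cycles X. h b)
    = - (\<Sum>b\<in>?P. (if cyclic_on b X then - of_nat (card X) else 0) * h b)"
    by (simp only: sum_distrib_left flip: sum_negf) (rule sum.cong, auto)
  also have "(\<Sum>b\<in>?P. (if cyclic_on b X then - of_nat (card X) else 0) * h b)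
    = (\<Sum>b\<in>?P. \<Sum>S\<in>invariant_subsets b X. of_nat (card S) * (-1) ^ num_cycles S b * h b)"
  proof (intro sum.cong refl)
    fix b assume "b \<in> ?P"
    then have "permutation b" "b ` X = X"
      using permutes_imp_permutation[OF assms] permutes_image by simp_all
    from sum_invariant_subsets_card[OF this assms, where 'b = 'b, symmetric]
    show "(if cyclic_on b X then - of_nat (card X) else 0) * h b
      = (\<Sum>S\<in>invariant_subsets b X. of_nat (card S) * (-1) ^ num_cycles S b * h b)"
      by (simp only: sum_distrib_right)
  qed
  finally show ?thesis .
qed

lemma sum_full_cycles_conv_signed_stabilizer_sum:
  fixes h :: "('a \<Rightarrow> 'a) \<Rightarrow> 'b :: comm_ring_1"
  assumes "finite X"
  shows "of_nat (card X) * (\<Sum>b\<in>full_cycles X. h b)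
    = - (\<Sum>S\<in>Pow X. of_nat (card S) * ((-1) ^ card S * signed_stabilizer_sum X S h))"
proof -
  let ?P = "{b. b permutes X}" and ?g = "\<lambda>b S. of_nat (card S) * (-1) ^ num_cycles S b * h b"
  have "(\<Sum>b\<in>?P. \<Sum>S\<in>invariant_subsets b X. ?g b S) = (\<Sum>b\<in>?P. \<Sum>S | S \<in> Pow X \<and> b ` S = S. ?g b S)"
    by (simp add: invariant_subsets_def)
  also have "\<dots> = (\<Sum>S\<in>Pow X. \<Sum>b | b \<in> ?P \<and> b ` S = S. ?g b S)"
    by (rule sum.swap_restrict) (use finite_permutations[OF assms] assms in auto)
  also have "\<dots> = (\<Sum>S\<in>Pow X. of_nat (card S) * ((-1) ^ card S * signed_stabilizer_sum X S h))"
    unfolding signed_stabilizer_sum_def sum_distrib_left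
  proof (intro sum.cong)
    fix S b assume S: "S \<in> Pow X" and b: "b \<in> set_stabilizer X S"
    have "finite S" using S assms finite_subset by auto
    then have "(-1) ^ card S * of_int (sign_on S b) = (-1 :: 'b) ^ num_cycles S b"
      using sign_on_eq_num_cycles[OF _ set_stabilizer_bij_betw(1)[OF b]]
      by (simp add: power_add flip: mult.assoc)
    then show "?g b S = of_nat (card S) * ((-1) ^ card S * (of_int (sign_on S b) * h b))"
      by (simp only: mult.assoc[symmetric])
  qed (auto simp: set_stabilizer_def)
  finally show ?thesis unfolding sum_full_cycles_conv_invariant_subsets[OF assms] by (rule arg_cong)
qed

lemma card_full_cycles:
  assumes "finite X" "X \<noteq> {}"
  shows "card (full_cycles X) = fact (card X - 1)"
proof -
  have "- (of_nat (card S) * ((-1) ^ card S * signed_stabilizer_sum X S (\<lambda>_. 1)))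
    = (if card S = 1 then fact (card X - 1) else 0 :: int)" if S: "S \<in> Pow X" for S
  proof -
    have "signed_stabilizer_sum X S (\<lambda>_. 1 :: int)
      = (-1) ^ card S * pochhammer (-1) (card S) * fact (card X - card S)"
      using signed_stabilizer_sum_power_num_cycles[OF assms(1), of S "1 :: int"] S
      by (simp add: pochhammer_fact)
    moreover have "pochhammer (-1) (card S) = (0 :: int)" if "card S > 1"
      using pochhammer_of_nat_eq_0_lemma[of 1 "card S", where 'a = int] that by simp
    ultimately show ?thesis by (cases "card S > 1") (auto simp: not_less le_Suc_eq)
  qed
  then have "of_nat (card X) * (\<Sum>b\<in>full_cycles X. 1)
    = (\<Sum>S\<in>Pow X. if card S = 1 then fact (card X - 1) else 0 :: int)"
    unfolding sum_full_cycles_conv_signed_stabilizer_sum[OF assms(1)] sum_negf[symmetric]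
    by (intro sum.cong refl) simp
  also have "\<dots> = of_nat (card X) * fact (card X - 1)"
    using n_subsets[OF assms(1), of 1] assms(1) by (simp flip: sum.inter_filter)
  finally have "int (card X * card (full_cycles X)) = int (card X * fact (card X - 1))" by simp
  then have "card X * card (full_cycles X) = card X * fact (card X - 1)"
    by (simp only: of_nat_eq_iff)
  then show ?thesis using assms by simp
qed

section \<open>Products of a fixed-point-free involution with full cycles\<close>

definition signed_cycle_sum :: "'b :: comm_ring_1 \<Rightarrow> 'a set \<Rightarrow> ('a \<Rightarrow> 'a) \<Rightarrow> 'a set \<Rightarrow> 'b" where
  "signed_cycle_sum y X a S = signed_stabilizer_sum X S (\<lambda>b. y ^ num_cycles X (a \<circ> b))"

text \<open>Conjugating \<open>a \<circ> b\<close> by the transposition of \<open>a s\<close> and \<open>a s'\<close> keeps its number of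
  cycles but flips the sign of \<open>b\<close> on \<open>S\<close>.\<close>

lemma signed_cycle_sum_eq_0:
  fixes y :: "'b :: {idom, ring_char_0}"
  assumes "finite X" "S \<subseteq> X" "a permutes X" "{s, s'} \<subseteq> exit_points a S" "s \<noteq> s'"
  shows "signed_cycle_sum y X a S = 0"
proof -
  define \<sigma> \<tau> where "\<sigma> = Transposition.transpose s s'" and "\<tau> = Transposition.transpose (a s) (a s')"
  have s: "s \<in> S" "s' \<in> S" "a s \<in> X - S" "a s' \<in> X - S"
    using assms(2,4) permutes_in_image[OF assms(3)] by (auto simp: exit_points_def)
  have \<sigma>: "\<sigma> \<in> set_stabilizer X S" and \<tau>: "\<tau> \<in> set_stabilizer X S"
    unfolding \<sigma>_def \<tau>_def by (rule transpose_in_set_stabilizer; use assms(2) s in simp)+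
  have "sign_on S \<tau> = sign_on S id"
    using s by (intro sign_on_cong) (auto simp: \<tau>_def Transposition.transpose_def)
  moreover have "sign_on S \<sigma> = - 1"
    unfolding \<sigma>_def using s(1,2) assms(5) by (rule sign_on_transpose)
  ultimately have sign: "sign_on S \<sigma> * sign_on S \<tau> = - 1" by simp
  have "a \<circ> \<sigma> = \<tau> \<circ> a"
    using permutes_inj[OF assms(3)] by (auto simp: \<sigma>_def \<tau>_def Transposition.transpose_def inj_eq)
  then have "a \<circ> (\<sigma> \<circ> b \<circ> \<tau>) = \<tau> \<circ> (a \<circ> b) \<circ> \<tau>" for b by (simp only: o_assoc)
  moreover have "num_cycles X (\<tau> \<circ> (a \<circ> b) \<circ> \<tau>) = num_cycles X (a \<circ> b)"
    if "b \<in> set_stabilizer X S" for b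
  proof -
    have "\<tau> permutes X" "a \<circ> b permutes X"
      using that \<tau> permutes_compose[OF _ assms(3)] by (simp_all add: set_stabilizer_def)
    moreover have "inv \<tau> = \<tau>" by (simp add: \<tau>_def)
    ultimately show ?thesis using num_cycles_conj[OF assms(1)] by metis
  qed
  ultimately have "signed_cycle_sum y X a S
    = signed_stabilizer_sum X S (\<lambda>b. y ^ num_cycles X (a \<circ> (\<sigma> \<circ> b \<circ> \<tau>)))"
    by (simp only: signed_cycle_sum_def signed_stabilizer_sum_def cong: sum.cong)
  also have "\<dots> = - signed_cycle_sum y X a S"
    using signed_stabilizer_sum_translate[OF finite_subset[OF assms(2,1)] \<sigma> \<tau>,
        of "\<lambda>b. y ^ num_cycles X (a \<circ> b)"] sign
    by (simp add: signed_cycle_sum_def)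
  finally have "2 * signed_cycle_sum y X a S = 0"
    unfolding mult_2 by (simp only: eq_neg_iff_add_eq_0)
  then show ?thesis by simp
qed

lemma signed_cycle_sum_absorb:
  fixes y :: "'b :: comm_ring_1"
  assumes "finite S" "c \<in> set_stabilizer X S"
  shows "signed_cycle_sum y X a S
    = of_int (sign_on S c) * signed_stabilizer_sum X S (\<lambda>b. y ^ num_cycles X (a \<circ> c \<circ> b))"
proof -
  have id: "id \<in> set_stabilizer X S" by (simp add: set_stabilizer_def permutes_id)
  have "signed_stabilizer_sum X S (\<lambda>b. y ^ num_cycles X (a \<circ> c \<circ> b))
    = of_int (sign_on S c) * signed_cycle_sum y X a S"
    using signed_stabilizer_sum_translate[OF assms id, of "\<lambda>b. y ^ num_cycles X (a \<circ> b)"]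
    by (simp add: signed_cycle_sum_def o_assoc)
  moreover have "of_int (sign_on S c) * (of_int (sign_on S c) :: 'b) = 1"
    by (simp add: sign_on_def sign_idempotent flip: of_int_mult)
  ultimately show ?thesis by (metis mult.assoc mult_1)
qed

lemma sign_on_fpf_involution:
  assumes "a \<in> fpf_involutions X" "finite X" "S \<in> invariant_subsets a X"
  shows "sign_on S a = (-1) ^ (card S div 2)"
proof -
  have "finite S" "bij_betw a S S"
    using assms(3) finite_subset[OF _ assms(2)] permutes_inj_on[OF fpf_involutionD(1)[OF assms(1)]]
    by (auto simp: invariant_subsets_def bij_betw_def)
  then show ?thesis
    using card_invariant_fpf_involution[OF assms]
    by (simp add: sign_on_eq_num_cycles power_add power_mult)
qed

lemma signed_cycle_sum_invariant:
  fixes a :: "'a \<Rightarrow> 'a" and y :: "'b :: comm_ring_1"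
  assumes "a \<in> fpf_involutions X" "finite X" "S \<in> invariant_subsets a X"
  shows "signed_cycle_sum y X a S
    = (-1) ^ (card S div 2) * (pochhammer (- y) (card S) * pochhammer y (card X - card S))"
proof -
  note a = fpf_involutionD[OF assms(1)]
  have S: "S \<subseteq> X" "a \<in> set_stabilizer X S"
    using assms(3) a(1) by (auto simp: invariant_subsets_def set_stabilizer_def)
  have "a \<circ> a \<circ> b = b" for b :: "'a \<Rightarrow> 'a" by (simp add: fun_eq_iff a(2))
  then have "signed_cycle_sum y X a S
    = of_int (sign_on S a) * signed_stabilizer_sum X S (\<lambda>b. y ^ num_cycles X b)"
    using signed_cycle_sum_absorb[OF finite_subset[OF S(1) assms(2)] S(2), of y a] by (simp only:)
  moreover have "even (card S)" using card_invariant_fpf_involution[OF assms] by simp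
  ultimately show ?thesis
    by (simp add: signed_stabilizer_sum_power_num_cycles[OF assms(2) S(1)]
        sign_on_fpf_involution[OF assms])
qed

lemma num_cycles_transpose_comp_stabilizer:
  assumes "finite X" "S \<subseteq> X" "b \<in> set_stabilizer X S" "s \<in> S" "t \<in> X - S"
  shows "num_cycles X (Transposition.transpose s t \<circ> b) = num_cycles X b - 1"
proof -
  have b: "b permutes X" "b ` S = S" using assms(3) by (auto simp: set_stabilizer_def)
  have "orbit b s \<subseteq> S" using assms(4) b(2) by (intro orbit_subset_if_closed) auto
  then have "t \<notin> orbit b s" using assms(5) by blast
  then show ?thesis using num_cycles_transpose_comp[OF b(1) assms(1), of s t] assms(2,4,5) by auto
qed

lemma odd_card_if_one_exit_point:
  assumes "a \<in> fpf_involutions X" "finite X" "S \<subseteq> X" "exit_points a S = {s}"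
  shows "odd (card S)" "card S div 2 = card (S - {s}) div 2"
proof -
  have "S - {s} \<in> invariant_subsets a X"
    using invariant_subsets_Diff_exit_point[OF assms(1,3,4)] by (auto simp: invariant_subsets_def)
  then have "even (card (S - {s}))" using card_invariant_fpf_involution[OF assms(1,2)] by simp
  moreover have "card S = Suc (card (S - {s}))"
    using assms(4) finite_subset[OF assms(3,2)]
    by (intro card_Suc_Diff1[symmetric]) (auto simp: exit_points_def)
  ultimately show "odd (card S)" "card S div 2 = card (S - {s}) div 2" by simp_all
qed

lemma transpose_comp_exit_point:
  assumes "a \<in> fpf_involutions X" "finite X" "S \<subseteq> X" "exit_points a S = {s}"
  shows "Transposition.transpose s (a s) \<circ> a \<in> set_stabilizer X S"
    and "sign_on S (Transposition.transpose s (a s) \<circ> a) = (-1) ^ (card S div 2)"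
proof -
  let ?c = "Transposition.transpose s (a s) \<circ> a" and ?P = "S - {s}"
  note a = fpf_involutionD[OF assms(1)]
  have s: "s \<in> S" "a s \<in> X"
    using assms(3,4) permutes_in_image[OF a(1)] by (auto simp: exit_points_def)
  have P: "?P \<subseteq> X - {s, a s}" "a ` ?P = ?P" "?P \<in> invariant_subsets a X"
    using invariant_subsets_Diff_exit_point[OF assms(1,3,4)] by (auto simp: invariant_subsets_def)
  have c_s: "?c s = s" by simp
  have c_P: "?c x = a x" if "x \<in> ?P" for x
  proof -
    have "a x \<in> ?P" using that P(2) by blast
    then have "a x \<noteq> s" "a x \<noteq> a s" using P(1) by auto
    then show ?thesis by simp
  qed
  have "?c permutes X" using a(1) s assms(3) by (auto intro!: permutes_compose permutes_swap_id)
  moreover have "?c ` insert s ?P = insert s ?P"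
    using c_s c_P P(2) by (simp only: image_insert image_cong[OF refl c_P])
  ultimately show "?c \<in> set_stabilizer X S"
    using s(1) by (simp add: set_stabilizer_def insert_absorb)
  have "restrict_id ?c S = restrict_id a ?P"
    using c_s c_P by (auto simp: restrict_id_def fun_eq_iff)
  then have "sign_on S ?c = sign_on ?P a" by (simp only: sign_on_def)
  then show "sign_on S ?c = (-1) ^ (card S div 2)"
    using sign_on_fpf_involution[OF assms(1,2) P(3)] odd_card_if_one_exit_point(2)[OF assms] by simp
qed

lemma signed_cycle_sum_exit_point:
  fixes a :: "'a \<Rightarrow> 'a" and y :: "'b :: comm_ring_1"
  assumes "a \<in> fpf_involutions X" "finite X" "S \<subseteq> X" "exit_points a S = {s}"
  shows "signed_cycle_sum y X a S
    = (-1) ^ (card S div 2) * (pochhammer (1 - y) (card S - 1) * pochhammer y (card X - card S))"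
proof -
  let ?t = "Transposition.transpose s (a s)"
  note a = fpf_involutionD[OF assms(1)] and c = transpose_comp_exit_point[OF assms]
  have s: "s \<in> S" "a s \<in> X - S"
    using assms(3,4) permutes_in_image[OF a(1)] by (auto simp: exit_points_def)
  have "a \<circ> (?t \<circ> a) \<circ> b = ?t \<circ> b" for b :: "'a \<Rightarrow> 'a"
    using a(2) permutes_inj[OF a(1)] by (auto simp: fun_eq_iff Transposition.transpose_def inj_eq)
  then have "signed_cycle_sum y X a S
    = (-1) ^ (card S div 2) * signed_stabilizer_sum X S (\<lambda>b. y ^ num_cycles X (?t \<circ> b))"
    using signed_cycle_sum_absorb[OF finite_subset[OF assms(3,2)] c(1), of y a] c(2)
    by (simp only: of_int_power of_int_minus of_int_1)
  also have "signed_stabilizer_sum X S (\<lambda>b. y ^ num_cycles X (?t \<circ> b))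
    = signed_stabilizer_sum X S (\<lambda>b. y ^ (num_cycles X b - 1))"
    unfolding signed_stabilizer_sum_def
    by (intro sum.cong refl) (simp only: num_cycles_transpose_comp_stabilizer[OF assms(2,3) _ s])
  also have "\<dots> = pochhammer (1 - y) (card S - 1) * pochhammer y (card X - card S)"
    using signed_stabilizer_sum_power_num_cycles_minus_one[OF assms(2,3), of y] s(1)
      odd_card_if_one_exit_point(1)[OF assms] by auto
  finally show ?thesis .
qed

lemma card_subsets_exit_point:
  assumes "a \<in> fpf_involutions X" "finite X" "s \<in> X"
  shows "card {S. S \<subseteq> X \<and> card S = Suc (2 * j) \<and> exit_points a S = {s}}
    = (card X div 2 - 1) choose j"
proof -
  note a = fpf_involutionD[OF assms(1)]
  let ?Y = "X - {s, a s}"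
  have "a s \<in> X" using permutes_in_image[OF a(1)] assms(3) by simp
  moreover have "a s \<noteq> s" using a(3)[OF assms(3)] .
  ultimately have "card ?Y = card X - 2"
    using assms(2,3) by (simp add: card_Diff_subset)
  then have card_Y: "card ?Y div 2 = card X div 2 - 1" by simp
  have "a x \<in> ?Y" if "x \<in> ?Y" for x
    using that a(2)[of x] a(2)[of s] permutes_in_image[OF a(1)] by auto
  then have "a ` ?Y = ?Y" by (rule image_involution_eq[OF a(2)])
  then have Y: "?Y \<in> invariant_subsets a X" by (simp add: invariant_subsets_def)
  have "card (insert s P) = Suc (2 * j) \<longleftrightarrow> card P = 2 * j" if "P \<in> invariant_subsets a ?Y" for P
  proof -
    have "finite P" "s \<notin> P"
      using that assms(2) by (auto simp: invariant_subsets_def intro: finite_subset)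
    then show ?thesis by simp
  qed
  with bij_betw_insert_exit_point[OF assms(1,3)]
  have "bij_betw (insert s) {P \<in> invariant_subsets a ?Y. card P = 2 * j}
    {S \<in> {S. S \<subseteq> X \<and> exit_points a S = {s}}. card S = Suc (2 * j)}"
    by (rule bij_betw_Collect)
  then have "card {P \<in> invariant_subsets a ?Y. card P = 2 * j}
    = card {S. S \<subseteq> X \<and> card S = Suc (2 * j) \<and> exit_points a S = {s}}"
    by (simp add: bij_betw_same_card conj_ac)
  then show ?thesis
    using card_invariant_subsets_fpf_involution[OF assms(1,2) Y, of j] by (simp only: card_Y)
qed

lemma exit_points_cases [consumes 3, case_names none one more]:
  assumes "a \<in> fpf_involutions X" "finite X" "S \<subseteq> X"
  obtains (none) "exit_points a S = {}" "S \<in> invariant_subsets a X" "even (card S)"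
    | (one) s where "exit_points a S = {s}" "odd (card S)"
    | (more) s s' where "{s, s'} \<subseteq> exit_points a S" "s \<noteq> s'"
proof (cases "exit_points a S = {}")
  case True
  then have "S \<in> invariant_subsets a X" using exit_points_empty_iff[OF assms(1,3)] by simp
  then show thesis using none[OF True] card_invariant_fpf_involution[OF assms(1,2)] by simp
next
  case False
  then obtain s where "s \<in> exit_points a S" by blast
  then show thesis
    using one[of s] more[of s] odd_card_if_one_exit_point(1)[OF assms, of s] by blast
qed

lemma sum_even_subsets_signed_cycle_sum:
  fixes y :: "'b :: {idom, ring_char_0}"
  assumes "a \<in> fpf_involutions X" "finite X"
  shows "(\<Sum>S | S \<subseteq> X \<and> card S = 2 * j. signed_cycle_sum y X a S)
    = (-1) ^ j * of_nat ((card X div 2) choose j)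
      * (pochhammer (- y) (2 * j) * pochhammer y (card X - 2 * j))"
proof -
  let ?I = "{S \<in> invariant_subsets a X. card S = 2 * j}"
  have "signed_cycle_sum y X a S = 0" if "S \<subseteq> X" "card S = 2 * j" "S \<notin> ?I" for S
    using assms that(1)
  proof (cases rule: exit_points_cases)
    case (more s s')
    then show ?thesis
      using signed_cycle_sum_eq_0[OF assms(2) that(1) fpf_involutionD(1)[OF assms(1)]] by blast
  qed (use that(2,3) in auto)
  then have "(\<Sum>S | S \<subseteq> X \<and> card S = 2 * j. signed_cycle_sum y X a S)
    = (\<Sum>S\<in>?I. signed_cycle_sum y X a S)"
    using assms(2) by (intro sum.mono_neutral_right) (auto simp: invariant_subsets_def)
  also have "\<dots> = (\<Sum>S\<in>?I. (-1) ^ j * (pochhammer (- y) (2 * j) * pochhammer y (card X - 2 * j)))"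
    by (intro sum.cong refl) (simp add: signed_cycle_sum_invariant[OF assms])
  moreover have "card ?I = (card X div 2) choose j"
    using fpf_involutionD(1)[OF assms(1)]
    by (intro card_invariant_subsets_fpf_involution[OF assms])
      (simp add: invariant_subsets_def permutes_image)
  ultimately show ?thesis by (simp add: ac_simps)
qed

lemma sum_odd_subsets_signed_cycle_sum:
  fixes y :: "'b :: {idom, ring_char_0}"
  assumes "a \<in> fpf_involutions X" "finite X"
  shows "(\<Sum>S | S \<subseteq> X \<and> card S = Suc (2 * j). signed_cycle_sum y X a S)
    = (-1) ^ j * of_nat (card X * ((card X div 2 - 1) choose j))
      * (pochhammer (1 - y) (2 * j) * pochhammer y (card X - Suc (2 * j)))"
proof -
  define E where "E s = {S. S \<subseteq> X \<and> card S = Suc (2 * j) \<and> exit_points a S = {s}}" for s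
  have fin: "finite (E s)" for s using assms(2) by (simp add: E_def)
  have "signed_cycle_sum y X a S = 0" if "S \<subseteq> X" "card S = Suc (2 * j)" "S \<notin> (\<Union>s\<in>X. E s)" for S
    using assms that(1)
  proof (cases rule: exit_points_cases)
    case (one s)
    then have "s \<in> X" using that(1) by (auto simp: exit_points_def)
    then show ?thesis using that one by (auto simp: E_def)
  next
    case (more s s')
    then show ?thesis
      using signed_cycle_sum_eq_0[OF assms(2) that(1) fpf_involutionD(1)[OF assms(1)]] by blast
  qed (use that(2) in auto)
  then have "(\<Sum>S | S \<subseteq> X \<and> card S = Suc (2 * j). signed_cycle_sum y X a S)
    = (\<Sum>S\<in>(\<Union>s\<in>X. E s). signed_cycle_sum y X a S)"
    using assms(2) by (intro sum.mono_neutral_right) (auto simp: E_def)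
  also have "\<dots> = (\<Sum>s\<in>X. \<Sum>S\<in>E s. signed_cycle_sum y X a S)"
    using assms(2) fin by (intro sum.UNION_disjoint) (auto simp: E_def)
  also have "\<dots> = (\<Sum>s\<in>X. \<Sum>S\<in>E s.
      (-1) ^ j * (pochhammer (1 - y) (2 * j) * pochhammer y (card X - Suc (2 * j))))"
  proof (intro sum.cong refl)
    fix s S assume "S \<in> E s"
    then have "S \<subseteq> X" "card S = Suc (2 * j)" "exit_points a S = {s}" by (auto simp: E_def)
    then show "signed_cycle_sum y X a S
      = (-1) ^ j * (pochhammer (1 - y) (2 * j) * pochhammer y (card X - Suc (2 * j)))"
      using signed_cycle_sum_exit_point[OF assms, of S s y] by simp
  qed
  also have "\<dots> = (\<Sum>s\<in>X. of_nat ((card X div 2 - 1) choose j)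
      * ((-1) ^ j * (pochhammer (1 - y) (2 * j) * pochhammer y (card X - Suc (2 * j)))))"
    by (intro sum.cong refl) (simp add: E_def card_subsets_exit_point[OF assms])
  finally show ?thesis by (simp add: ac_simps)
qed

text \<open>The value at a fixed-point-free involution of \<open>2 * n\<close> points of the irreducible character of
  the hook \<open>(2 * n - m, 1 ^ m)\<close>: the coefficient of \<open>q ^ m\<close> in \<open>(1 - q) * (1 - q\<^sup>2) ^ (n - 1)\<close>.\<close>

definition hook_character :: "nat \<Rightarrow> nat \<Rightarrow> 'b :: comm_ring_1" where
  "hook_character n m = (-1) ^ (m + m div 2) * of_nat ((n - 1) choose (m div 2))"

text \<open>Up to the sign \<open>(-1) ^ m\<close>, the product of \<open>y + c\<close> over the contents \<open>c\<close> of the cells of the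
  hook \<open>(N - m, 1 ^ m)\<close>.\<close>

definition hook_content_product :: "'b :: comm_ring_1 \<Rightarrow> nat \<Rightarrow> nat \<Rightarrow> 'b" where
  "hook_content_product y N m = pochhammer (1 - y) m * pochhammer y (N - m)"

definition hook_term :: "'b :: comm_ring_1 \<Rightarrow> nat \<Rightarrow> nat \<Rightarrow> 'b" where
  "hook_term y n m = hook_character n m * hook_content_product y (2 * n) m"

lemma hook_content_product_adjacent:
  assumes "Suc m \<le> N"
  shows "hook_content_product y N m
      = (y + of_nat (N - Suc m)) * (pochhammer (1 - y) m * pochhammer y (N - Suc m))"
    and "hook_content_product y N (Suc m)
      = (of_nat (Suc m) - y) * (pochhammer (1 - y) m * pochhammer y (N - Suc m))"
proof -
  have "N - m = Suc (N - Suc m)" using assms by simp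
  then show "hook_content_product y N m
    = (y + of_nat (N - Suc m)) * (pochhammer (1 - y) m * pochhammer y (N - Suc m))"
    by (simp only: hook_content_product_def pochhammer_Suc ac_simps)
  show "hook_content_product y N (Suc m)
    = (of_nat (Suc m) - y) * (pochhammer (1 - y) m * pochhammer y (N - Suc m))"
    by (simp add: hook_content_product_def pochhammer_Suc algebra_simps)
qed

lemma hook_character_double:
  "hook_character n (2 * j) = (-1) ^ j * of_nat ((n - 1) choose j)"
  "hook_character n (Suc (2 * j)) = - ((-1) ^ j * of_nat ((n - 1) choose j))"
  by (simp_all add: hook_character_def power_add power_mult)

lemma Suc_times_binomial_Suc: "Suc j * ((j + k) choose Suc j) = k * ((j + k) choose j)"
  using Suc_times_binomial_add[of j "k - 1"] by (cases k) (simp_all del: binomial_Suc_Suc mult_Suc)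

lemma hook_term_diff_odd:
  assumes "Suc (2 * j) \<le> 2 * n"
  shows "hook_term y n (Suc (2 * j)) - hook_term y n (2 * j)
    = - ((-1) ^ j * of_nat (2 * n * ((n - 1) choose j))
        * (pochhammer (1 - y) (2 * j) * pochhammer y (2 * n - Suc (2 * j))))"
    (is "_ = - (_ * _ * ?R)")
proof -
  let ?D = "hook_content_product y (2 * n)"
  have "?D (2 * j) + ?D (Suc (2 * j))
    = (y + of_nat (2 * n - Suc (2 * j)) + (of_nat (Suc (2 * j)) - y)) * ?R"
    unfolding hook_content_product_adjacent[OF assms] by (simp only: distrib_right)
  also have "y + of_nat (2 * n - Suc (2 * j)) + (of_nat (Suc (2 * j)) - y) = of_nat (2 * n)"
    using assms by (simp add: of_nat_diff)
  finally have content: "?D (2 * j) + ?D (Suc (2 * j)) = of_nat (2 * n) * ?R" .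
  have "hook_term y n (Suc (2 * j)) - hook_term y n (2 * j)
    = - ((-1) ^ j * of_nat ((n - 1) choose j) * (?D (2 * j) + ?D (Suc (2 * j))))"
    unfolding hook_term_def hook_character_double by (simp only: minus_mult_left distrib_left) simp
  then show ?thesis unfolding content by (simp add: ac_simps)
qed

lemma hook_term_diff_even:
  assumes "2 * Suc j \<le> 2 * n"
  shows "hook_term y n (2 * Suc j) - hook_term y n (Suc (2 * j))
    = (-1) ^ Suc j * of_nat (n choose Suc j)
        * (pochhammer (- y) (2 * Suc j) * pochhammer y (2 * n - 2 * Suc j))"
proof -
  have "Suc j \<le> n" using assms by simp
  then obtain k where k: "n = Suc (j + k)" by (auto simp: le_iff_add)
  define R where "R = pochhammer (1 - y) (Suc (2 * j)) * pochhammer y (2 * k)"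
  define A B :: 'a where "A = of_nat ((n - 1) choose j)" and "B = of_nat ((n - 1) choose Suc j)"
  have absorb: "of_nat (Suc j) * B = of_nat k * A"
    using Suc_times_binomial_Suc[of j k] unfolding A_def B_def k of_nat_mult[symmetric] by simp
  have pascal: "of_nat (n choose Suc j) = A + B" by (simp add: A_def B_def k)
  have "2 * n - Suc (Suc (2 * j)) = 2 * k" by (simp add: k)
  then have content:
    "hook_content_product y (2 * n) (Suc (2 * j)) = (y + 2 * of_nat k) * R"
    "hook_content_product y (2 * n) (2 * Suc j) = (2 * of_nat (Suc j) - y) * R"
    "pochhammer (- y) (2 * Suc j) * pochhammer y (2 * n - 2 * Suc j) = - y * R"
    using hook_content_product_adjacent[of "Suc (2 * j)" "2 * n" y] assms
    by (simp_all add: R_def pochhammer_rec[of "- y"])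
  have "hook_term y n (2 * Suc j) - hook_term y n (Suc (2 * j))
    = (-1) ^ Suc j * R * (2 * (of_nat (Suc j) * B) - y * B - y * A - 2 * (of_nat k * A))"
    unfolding hook_term_def content hook_character_double A_def[symmetric] B_def[symmetric]
    by (simp add: algebra_simps)
  also have "\<dots> = (-1) ^ Suc j * of_nat (n choose Suc j) * (- y * R)"
    unfolding absorb pascal by (simp add: algebra_simps)
  finally show ?thesis unfolding content .
qed

lemma sum_subsets_signed_cycle_sum:
  fixes y :: "'b :: {idom, ring_char_0}"
  assumes "a \<in> fpf_involutions X" "finite X" "card X = 2 * n" "m < 2 * n"
  shows "(-1) ^ Suc m * (\<Sum>S | S \<subseteq> X \<and> card S = Suc m. signed_cycle_sum y X a S)
    = hook_term y n (Suc m) - hook_term y n m"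
proof (cases "even m")
  case True
  then obtain j where m: "m = 2 * j" by (elim evenE)
  then show ?thesis
    using sum_odd_subsets_signed_cycle_sum[OF assms(1,2), of y j]
      hook_term_diff_odd[of j n y] assms(3,4)
    by simp
next
  case False
  then obtain j where m: "m = Suc (2 * j)" by (metis Suc_eq_plus1 oddE)
  then show ?thesis
    using sum_even_subsets_signed_cycle_sum[OF assms(1,2), of y "Suc j"]
      hook_term_diff_even[of j n y] assms(3,4)
    by simp
qed

lemma sum_full_cycles_power_num_cycles:
  fixes y :: "'b :: {idom, ring_char_0}"
  assumes "a \<in> fpf_involutions X" "finite X" "card X = 2 * n" "n \<ge> 1"
  shows "of_nat (2 * n) * (\<Sum>b\<in>full_cycles X. y ^ num_cycles X (a \<circ> b))
    = (\<Sum>m<2 * n. hook_term y n m)"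
proof -
  let ?H = "hook_term y n"
  define T where "T m = (-1) ^ m * (\<Sum>S | S \<subseteq> X \<and> card S = m. signed_cycle_sum y X a S)" for m
  have "(\<Sum>S\<in>Pow X. of_nat (card S) * ((-1) ^ card S * signed_cycle_sum y X a S))
    = (\<Sum>m\<le>2 * n. \<Sum>S | S \<in> Pow X \<and> card S = m.
        of_nat (card S) * ((-1) ^ card S * signed_cycle_sum y X a S))"
    using assms(2,3) card_mono by (intro sum.group[symmetric]) fastforce+
  also have "\<dots> = (\<Sum>m\<le>2 * n. of_nat m * T m)"
    by (simp add: T_def sum_distrib_left)
  also have "\<dots> = (\<Sum>m<2 * n. of_nat (Suc m) * T (Suc m))"
    by (simp add: sum.atMost_shift del: of_nat_Suc)
  also have "\<dots> = (\<Sum>m<2 * n. of_nat (Suc m) * (?H (Suc m) - ?H m))"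
    unfolding T_def
    by (intro sum.cong refl) (subst sum_subsets_signed_cycle_sum[OF assms(1-3)], auto)
  also have "\<dots> = of_nat (2 * n) * ?H (2 * n) - (\<Sum>m<2 * n. ?H m)"
  proof -
    have "(\<Sum>m<k. of_nat (Suc m) * (?H (Suc m) - ?H m)) = of_nat k * ?H k - (\<Sum>m<k. ?H m)" for k
      by (induction k) (simp_all add: algebra_simps)
    then show ?thesis .
  qed
  also have "?H (2 * n) = 0" using assms(4) by (simp add: hook_term_def hook_character_def)
  finally show ?thesis
    using sum_full_cycles_conv_signed_stabilizer_sum[OF assms(2),
        of "\<lambda>b. y ^ num_cycles X (a \<circ> b)"] assms(3)
    by (simp add: signed_cycle_sum_def)
qed

section \<open>Coefficients of the generating function\<close>

lemma sum_binomial_pochhammer_partial: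
  fixes y :: "'b :: comm_ring_1"
  shows "(\<Sum>i\<le>k.
      of_nat (Suc (k + m) choose i) * (pochhammer (- y) (Suc (k + m) - i) * pochhammer y i))
    = - (of_nat ((k + m) choose k) * (pochhammer (1 - y) m * pochhammer y (Suc k)))"
proof (induction k arbitrary: m)
  case 0
  then show ?case by (simp add: pochhammer_rec)
next
  case (Suc k)
  define R where "R = pochhammer (1 - y) m * pochhammer y (Suc k)"
  define A B :: 'b
    where "A = of_nat (Suc (k + m) choose k)" and "B = of_nat (Suc (k + m) choose Suc k)"
  have absorb: "of_nat (Suc m) * A = of_nat (Suc k) * B"
    using Suc_times_binomial_Suc[of k "Suc m"] unfolding A_def B_def of_nat_mult[symmetric] by simp
  have "(\<Sum>i\<le>k.
      of_nat (Suc (Suc k + m) choose i) * (pochhammer (- y) (Suc (Suc k + m) - i) * pochhammer y i))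
    = - (A * (pochhammer (1 - y) (Suc m) * pochhammer y (Suc k)))"
    using Suc.IH[of "Suc m"] by (simp add: A_def)
  also have "\<dots> = - (A * (of_nat (Suc m) - y) * R)"
    by (simp add: R_def pochhammer_Suc[of "1 - y"] algebra_simps)
  finally have "(\<Sum>i\<le>Suc k.
      of_nat (Suc (Suc k + m) choose i) * (pochhammer (- y) (Suc (Suc k + m) - i) * pochhammer y i))
    = - (A * (of_nat (Suc m) - y) * R) + (A + B) * (- y * R)"
    by (simp add: A_def B_def R_def pochhammer_rec[of "- y"])
  also have "\<dots> = - (of_nat (Suc m) * A * R + B * y * R)"
    by (simp add: algebra_simps)
  also have "\<dots> = - (B * ((y + of_nat (Suc k)) * R))"
    unfolding absorb by (simp add: algebra_simps)
  also have "\<dots> = - (B * (pochhammer (1 - y) m * pochhammer y (Suc (Suc k))))"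
    by (simp add: R_def pochhammer_Suc[of y "Suc k"] ac_simps)
  finally show ?case by (simp add: B_def)
qed

lemma fps_binomial_compose_uminus_nth:
  "fps_nth (fps_binomial z oo (- fps_X)) m = pochhammer (- z) m / fact m"
  for z :: "'a :: field_char_0"
proof -
  have "fps_nth (fps_binomial z oo (- fps_X)) m = (-1) ^ m * (z gchoose m)"
    by (simp add: fps_compose_uminus')
  then show ?thesis by (simp add: gbinomial_pochhammer)
qed

lemma GF_nth:
  "fps_nth (GF y) N = fps_X * inverse (1 - fps_X) * (\<Sum>i\<le>N.
    fps_const (pochhammer (- y) (N - i) / fact (N - i) * (pochhammer y i / fact i)) * fps_X ^ i)"
proof -
  have "fps_nth (one_minus_x_pow y * one_minus_xxi_pow y) N
    = fps_nth (one_minus_xxi_pow y * one_minus_x_pow y) N"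
    by (simp only: mult.commute)
  also have "\<dots> = (\<Sum>i\<le>N.
    fps_const (pochhammer (- y) (N - i) / fact (N - i) * (pochhammer y i / fact i)) * fps_X ^ i)"
    unfolding fps_mult_nth atMost_atLeast0
    by (intro sum.cong refl)
      (simp add: one_minus_x_pow_def one_minus_xxi_pow_def fps_binomial_compose_uminus_nth ac_simps
        flip: fps_const_mult)
  finally show ?thesis by (simp add: GF_def mult.assoc)
qed

lemma fact_times_GF_nth_nth:
  assumes "1 \<le> l" "l \<le> N"
  shows "fact N * fps_nth (fps_nth (GF y) N) l
    = - (real ((N - 1) choose (l - 1)) * hook_content_product y N (N - l))"
proof -
  obtain k m where l: "l = Suc k" and N: "N = Suc (k + m)"
    using assms by (metis Suc_le_D add_Suc le_iff_add One_nat_def)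
  define c where "c i = pochhammer (- y) (N - i) / fact (N - i) * (pochhammer y i / fact i)" for i
  have "fps_nth (\<Sum>i\<le>N. fps_const (c i) * fps_X ^ i) j = c j" if "j \<le> N" for j
    using that by (simp add: fps_sum_nth fps_X_power_nth if_distrib cong: if_cong)
  moreover have "fps_nth (fps_X * inverse (1 - fps_X) * f) l = (\<Sum>i\<le>k. fps_nth f i)"
    for f :: "real fps"
  proof -
    have "inverse (1 - fps_X) * f = Abs_fps (\<lambda>j. sum (fps_nth f) {0..j})"
      using fps_divide_fps_X_minus1_sum[of f] by (simp add: fps_divide_unit mult.commute)
    then show ?thesis by (simp add: l mult.assoc atMost_atLeast0)
  qed
  ultimately have "fps_nth (fps_nth (GF y) N) l = (\<Sum>i\<le>k. c i)"
    unfolding GF_nth c_def[symmetric] by (simp add: N)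
  also have "fact N * \<dots> = (\<Sum>i\<le>k. real (N choose i) * (pochhammer (- y) (N - i) * pochhammer y i))"
    unfolding sum_distrib_left c_def
    by (intro sum.cong refl) (simp add: N binomial_fact)
  also have "\<dots> = - (real ((N - 1) choose (l - 1)) * hook_content_product y N (N - l))"
    unfolding N l sum_binomial_pochhammer_partial by (simp add: hook_content_product_def)
  finally show ?thesis .
qed

lemma F_times_binomial:
  assumes "m < 2 * n"
  shows "F (2 * n) (2 * n - m) * real ((2 * n - 1) choose (2 * n - m - 1))
    = (-1) ^ (m div 2) * real ((n - 1) choose (m div 2))"
proof -
  define j where "j = m div 2"
  have denom: "real ((2 * n - 1) choose (2 * n - m - 1)) \<noteq> 0" using assms by simp
  have j: "j \<le> n - 1" using assms by (simp add: j_def)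
  have "F (2 * n) (2 * n - m)
    = (-1) ^ j * real ((n - 1) choose (n - 1 - j)) / real ((2 * n - 1) choose (2 * n - m - 1))"
  proof (cases "even m")
    case True
    then have m: "m = 2 * j" by (simp add: j_def)
    have "even (2 * n - m)" "(2 * n + 1 - (2 * n - m) - 1) div 2 = j" "(2 * n - 2) div 2 = n - 1"
      "(2 * n - m - 2) div 2 = n - 1 - j"
      using assms by (simp_all add: m)
    then show ?thesis by (simp only: F_def Let_def if_True)
  next
    case False
    then have m: "m = Suc (2 * j)" by (simp add: j_def odd_two_times_div_two_succ)
    have "odd (2 * n - m)" "(2 * n + 1 - (2 * n - m) + 2) div 2 = Suc (Suc j)"
      "(2 * n - 2) div 2 = n - 1"
      "(2 * n - m - 1) div 2 = n - 1 - j"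
      using assms by (simp_all add: m)
    then show ?thesis by (simp only: F_def Let_def if_False) simp
  qed
  then show ?thesis
    using denom binomial_symmetric[OF j] by (simp add: j_def)
qed

lemma fact_times_sum_F_GF:
  fixes n :: nat and y :: real
  defines "N \<equiv> 2 * n"
  shows "fact N * (\<Sum>l = 1..N. (-1) ^ (N + 1 - l) * F N l * fps_nth (fps_nth (GF y) N) l)
    = (\<Sum>m<N. hook_term y n m)"
proof -
  have "fact N * (\<Sum>l = 1..N. (-1) ^ (N + 1 - l) * F N l * fps_nth (fps_nth (GF y) N) l)
    = (\<Sum>l = 1..N. (-1) ^ (N + 1 - l) * F N l * (fact N * fps_nth (fps_nth (GF y) N) l))"
    by (simp add: sum_distrib_left ac_simps)
  also have "\<dots> = (\<Sum>m<N. (-1) ^ (N + 1 - (N - m)) * F N (N - m)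
      * (fact N * fps_nth (fps_nth (GF y) N) (N - m)))"
    by (rule sum.reindex_bij_witness[of _ "\<lambda>m. N - m" "\<lambda>l. N - l"]) auto
  also have "\<dots> = (\<Sum>m<N. hook_term y n m)"
  proof (intro sum.cong refl)
    fix m assume "m \<in> {..<N}"
    then have m: "m < N" "1 \<le> N - m" "N - m \<le> N" "N - (N - m) = m" "N + 1 - (N - m) = Suc m"
      by auto
    have "(-1) ^ Suc m * F N (N - m) * (fact N * fps_nth (fps_nth (GF y) N) (N - m))
      = (-1) ^ m * (F N (N - m) * real ((N - 1) choose (N - m - 1))) * hook_content_product y N m"
      unfolding fact_times_GF_nth_nth[OF m(2,3)] m(4) by simp
    then show "(-1) ^ (N + 1 - (N - m)) * F N (N - m)
      * (fact N * fps_nth (fps_nth (GF y) N) (N - m)) = hook_term y n m"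
      unfolding m(5) F_times_binomial[OF m(1)[unfolded N_def], folded N_def]
      by (simp add: hook_term_def hook_character_def power_add N_def)
  qed
  finally show ?thesis .
qed

lemma expectation_pair_pmf_of_set:
  fixes f :: "'a \<times> 'b \<Rightarrow> real"
  assumes "finite A" "A \<noteq> {}" "finite B" "B \<noteq> {}"
  shows "measure_pmf.expectation (pair_pmf (pmf_of_set A) (pmf_of_set B)) f
    = (\<Sum>a\<in>A. \<Sum>b\<in>B. f (a, b)) / (real (card A) * real (card B))"
proof -
  have "pair_pmf (pmf_of_set A) (pmf_of_set B) = pmf_of_set (A \<times> B)"
  proof (rule pmf_eqI)
    fix z :: "'a \<times> 'b"
    show "pmf (pair_pmf (pmf_of_set A) (pmf_of_set B)) z = pmf (pmf_of_set (A \<times> B)) z"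
      using assms by (cases z) (simp add: pmf_pair card_cartesian_product indicator_times)
  qed
  then show ?thesis
    using assms by (simp add: integral_pmf_of_set sum.cartesian_product card_cartesian_product)
qed

theorem theorem2p1:
  fixes n :: nat and y :: real
  assumes "n \<ge> 1"
  defines "N \<equiv> 2 * n"
  shows "measure_pmf.expectation
           (pair_pmf (pmf_of_set (fpf_involutions {1..N})) (pmf_of_set (full_cycles {1..N})))
           (\<lambda>(a, b). y ^ num_cycles {1..N} (a \<circ> b))
         = (\<Sum>l = 1..N. (-1) ^ (N + 1 - l) * F N l * fps_nth (fps_nth (GF y) N) l)"
    (is "measure_pmf.expectation (pair_pmf (pmf_of_set ?A) (pmf_of_set ?B)) _ = ?R")
proof -
  have "?A \<subseteq> {p. p permutes {1..N}}" "?B \<subseteq> {p. p permutes {1..N}}"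
    by (auto simp: fpf_involutions_def full_cycles_def)
  then have fin: "finite ?A" "finite ?B"
    using finite_permutations[of "{1..N}"] finite_subset by blast+
  have card: "card ?B = fact (N - 1)"
    using card_full_cycles[of "{1..N}"] assms by simp
  have N_nonzero: "real N \<noteq> 0" using assms by simp
  from card have ne: "?A \<noteq> {}" "?B \<noteq> {}"
    using fpf_involutions_nonempty[of "{1..N}"] by (auto simp: N_def)
  have "(\<Sum>b\<in>?B. y ^ num_cycles {1..N} (a \<circ> b)) = real (card ?B) * ?R" if "a \<in> ?A" for a
  proof -
    have "real N * (\<Sum>b\<in>?B. y ^ num_cycles {1..N} (a \<circ> b)) = fact N * ?R"
      unfolding N_def fact_times_sum_F_GF
      by (rule sum_full_cycles_power_num_cycles) (use that assms in \<open>simp_all add: N_def\<close>)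
    also have "fact N = real N * real (card ?B)"
      unfolding card using assms by (subst fact_reduce) simp_all
    finally show ?thesis by (simp only: mult.assoc mult_cancel_left N_nonzero simp_thms)
  qed
  then have "(\<Sum>a\<in>?A. \<Sum>b\<in>?B. y ^ num_cycles {1..N} (a \<circ> b)) = real (card ?A) * real (card ?B) * ?R"
    by simp
  then show ?thesis using fin ne by (simp add: expectation_pair_pmf_of_set)
qed

end
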